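(* Let $\Phi$ be a unital commutative ring containing $\frac12$, let $X=X^+\cup X^-$ be a polarized set, and let $f\in\mathcal{L}(X^+,X^-)$ be a 3-graded polynomial, i.e. an element of the free 3-graded Lie algebra over $\Phi$ on $X$. Then $\pi(f)\in S\mathcal{L}(X^+,X^-)$ is nonzero if and only if there exist $p,q\in\mathbb{N}$ such that $f$ is not an identity of the 3-graded Lie algebra $sl(p+q)$. Thus, if $\Phi$ is a field, $f$ is an essential 3-graded polynomial if and only if there exist $p,q\in\mathbb{N}$ such that $f$ is not an identity of $sl(p+q)$.
   Context: A Lie algebra $L$ is 3-graded if $L=L_1\oplus L_0\oplus L_{-1}$ with $[L_i,L_j]\subseteq L_{i+j}$, where $L_k=0$ for $k\notin\{0,\pm1\}$. For a polarized set of variables $X=X^+\cup X^-$ (disjoint union), $\mathcal{L}(X^+,X^-)$ denotes the free 3-graded Lie algebra over $\Phi$ on $X$: the 3-graded Lie algebra generated by $X$ with $X^{\pm}$ in degrees $\pm1$, such that every map $\varphi:X\to G$ into a 3-graded Lie algebra $G$ with $\varphi(X^\sigma)\subseteq G_\sigma$ ($G_+=G_1$, $G_-=G_{-1}$) extends uniquely to a homomorphism $\mathcal{L}(X^+,X^-)\to G$. The element $f$ is a (3-graded polynomial) identity of a 3-graded Lie algebra $L$ if all such extensions to $L$ send $f$ to $0$. Let $Ass[X^+,X^-]$ be the free 3-graded associative algebra on $X$, i.e. the quotient of the free associative $\Phi$-algebra on $X$ by the ideal generated by all $x^\sigma y^\sigma$ with $x^\sigma,y^\sigma\in X^\sigma$,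 $\sigma=\pm$. $S\mathcal{L}(X^+,X^-)$ is the Lie subalgebra of $Ass[X^+,X^-]^{(-)}$ (the algebra $Ass[X^+,X^-]$ with the commutator product) generated by $X$, and $\pi:\mathcal{L}(X^+,X^-)\to S\mathcal{L}(X^+,X^-)$ is the unique homomorphism of 3-graded Lie algebras that is the identity on $X$. The 3-graded polynomial $f$ is essential if its image $\pi(f)\in S\mathcal{L}(X^+,X^-)\subseteq Ass[X^+,X^-]$ is nonzero and has a monic leading term (of highest degree) as an associative polynomial. For $p,q\in\mathbb{N}$, $sl(p+q)$ is the Lie algebra of traceless $(p+q)\times(p+q)$ matrices over $\Phi$, with the 3-grading by blocks: $sl(p+q)_1=\begin{pmatrix} 0 & M_{p,q}(\Phi) \\ 0 & 0 \end{pmatrix}$, $sl(p+q)_{-1}=\begin{pmatrix} 0 & 0 \\ M_{q,p}(\Phi) & 0 \end{pmatrix}$, and $sl(p+q)_0$ the traceless block diagonal matrices in $M_p(\Phi)\oplus M_q(\Phi)$.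
   Formalization: "Monic leading term" in the definition of essential is read up to multiplication by a unit of Φ; with leading coefficient literally 1 the final claim fails, e.g. for f = 3[x,y] over the rationals. *)

theory Defs
  imports "Jordan_Normal_Form.VS_Connect" "HOL-Algebra.QuotRing"
begin

hide_const (open) Multiset.mult Modules.module Polynomial.smult

section \<open>Algebras over a commutative ring\<close>

text \<open>The ring of scalars is a type \<open>'k :: comm_ring_1\<close>, viewed as the record \<open>class_ring\<close> where a
  module is needed. An algebra is a \<open>module\<close> record whose \<open>mult\<close> field holds the product, which
  for a Lie algebra is the bracket. The field \<open>one\<close> plays no role and is left undefined.\<close>

record ('k, 'a) graded_algebra = "('k, 'a) module" +
  grade :: "int \<Rightarrow> 'a set"

locale nonassoc_algebra = Module.module "class_ring :: 'k::comm_ring_1 ring" A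
  for A :: "('k::comm_ring_1, 'a, 'm) module_scheme" (structure) +
  assumes mult_closed: "\<lbrakk>x \<in> carrier A; y \<in> carrier A\<rbrakk> \<Longrightarrow> x \<otimes> y \<in> carrier A"
    and mult_l_distr: "\<lbrakk>x \<in> carrier A; y \<in> carrier A; z \<in> carrier A\<rbrakk>
          \<Longrightarrow> (x \<oplus> y) \<otimes> z = x \<otimes> z \<oplus> y \<otimes> z"
    and mult_r_distr: "\<lbrakk>x \<in> carrier A; y \<in> carrier A; z \<in> carrier A\<rbrakk>
          \<Longrightarrow> z \<otimes> (x \<oplus> y) = z \<otimes> x \<oplus> z \<otimes> y"
    and mult_smult_l: "\<lbrakk>x \<in> carrier A; y \<in> carrier A\<rbrakk> \<Longrightarrow> (c \<odot> x) \<otimes> y = c \<odot> (x \<otimes> y)"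
    and mult_smult_r: "\<lbrakk>x \<in> carrier A; y \<in> carrier A\<rbrakk> \<Longrightarrow> x \<otimes> (c \<odot> y) = c \<odot> (x \<otimes> y)"

locale lie_algebra = nonassoc_algebra L
  for L :: "('k::comm_ring_1, 'l, 'm) module_scheme" (structure) +
  assumes alternating: "x \<in> carrier L \<Longrightarrow> x \<otimes> x = \<zero>"
    and jacobi: "\<lbrakk>x \<in> carrier L; y \<in> carrier L; z \<in> carrier L\<rbrakk>
          \<Longrightarrow> (x \<otimes> y) \<otimes> z \<oplus> (y \<otimes> z) \<otimes> x \<oplus> (z \<otimes> x) \<otimes> y = \<zero>"

locale graded3_lie_algebra = lie_algebra L
  for L :: "('k::comm_ring_1, 'l, 'm) graded_algebra_scheme" (structure) +
  assumes grade_submodule: "Module.submodule (grade L k) class_ring L"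
    and grade_trivial: "k \<notin> {-1, 0, 1} \<Longrightarrow> grade L k = {\<zero>}"
    and grade_sum: "x \<in> carrier L \<Longrightarrow>
          \<exists>a \<in> grade L 1. \<exists>b \<in> grade L 0. \<exists>c \<in> grade L (-1). x = a \<oplus> b \<oplus> c"
    and grade_direct: "\<lbrakk>a \<in> grade L 1; b \<in> grade L 0; c \<in> grade L (-1); a \<oplus> b \<oplus> c = \<zero>\<rbrakk>
          \<Longrightarrow> a = \<zero> \<and> b = \<zero> \<and> c = \<zero>"
    and grade_mult: "\<lbrakk>x \<in> grade L i; y \<in> grade L j\<rbrakk> \<Longrightarrow> x \<otimes> y \<in> grade L (i + j)"

text \<open>Homomorphisms are made extensional outside the carrier, so that uniqueness is meaningful.\<close>

definition graded_hom ::
  "('k::comm_ring_1, 'a, 'm) graded_algebra_scheme \<Rightarrow> ('k, 'b, 'n) graded_algebra_scheme \<Rightarrow> ('a \<Rightarrow> 'b) set"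
  where "graded_hom A B = {h \<in> carrier A \<rightarrow>\<^sub>E carrier B.
    (\<forall>x \<in> carrier A. \<forall>y \<in> carrier A. h (x \<oplus>\<^bsub>A\<^esub> y) = h x \<oplus>\<^bsub>B\<^esub> h y) \<and>
    (\<forall>c. \<forall>x \<in> carrier A. h (c \<odot>\<^bsub>A\<^esub> x) = c \<odot>\<^bsub>B\<^esub> h x) \<and>
    (\<forall>x \<in> carrier A. \<forall>y \<in> carrier A. h (x \<otimes>\<^bsub>A\<^esub> y) = h x \<otimes>\<^bsub>B\<^esub> h y) \<and>
    (\<forall>k. h ` grade A k \<subseteq> grade B k)}"

definition subalgebra :: "('k::comm_ring_1, 'a, 'm) module_scheme \<Rightarrow> 'a set \<Rightarrow> bool"
  where "subalgebra A B \<longleftrightarrow> Module.submodule B class_ring A \<and> (\<forall>x \<in> B. \<forall>y \<in> B. x \<otimes>\<^bsub>A\<^esub> y \<in> B)"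

definition algebra_ideal :: "('k::comm_ring_1, 'a, 'm) module_scheme \<Rightarrow> 'a set \<Rightarrow> bool"
  where "algebra_ideal A I \<longleftrightarrow> Module.submodule I class_ring A \<and>
    (\<forall>x \<in> carrier A. \<forall>y \<in> I. x \<otimes>\<^bsub>A\<^esub> y \<in> I \<and> y \<otimes>\<^bsub>A\<^esub> x \<in> I)"

text \<open>The quotient by an ideal, on additive cosets, graded by the images of the graded pieces.\<close>

definition quotient_algebra ::
  "('k::comm_ring_1, 'a) graded_algebra \<Rightarrow> 'a set \<Rightarrow> ('k, 'a set) graded_algebra"
  where "quotient_algebra A I =
    \<lparr>carrier = a_rcosets\<^bsub>A\<^esub> I, mult = rcoset_mult A I, one = undefined, zero = I, add = set_add A,
     smult = (\<lambda>c C. \<Union>x \<in> C. I +>\<^bsub>A\<^esub> (c \<odot>\<^bsub>A\<^esub> x)),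
     grade = (\<lambda>k. (\<lambda>x. I +>\<^bsub>A\<^esub> x) ` grade A k)\<rparr>"

definition commutator_algebra ::
  "('k::comm_ring_1, 'a) graded_algebra \<Rightarrow> ('k, 'a) graded_algebra"
  where "commutator_algebra A = A\<lparr>mult := \<lambda>x y. x \<otimes>\<^bsub>A\<^esub> y \<ominus>\<^bsub>A\<^esub> y \<otimes>\<^bsub>A\<^esub> x\<rparr>"

definition generated_subalgebra ::
  "('k::comm_ring_1, 'a) graded_algebra \<Rightarrow> 'a set \<Rightarrow> ('k, 'a) graded_algebra"
  where "generated_subalgebra A S =
    A\<lparr>carrier := subalgebra A hull S, grade := \<lambda>k. grade A k \<inter> (subalgebra A hull S)\<rparr>"


section \<open>Free algebras\<close>

text \<open>The free module with basis \<open>M\<close>, as finitely supported functions, with product extending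
  \<open>mul\<close> bilinearly. Each element of \<open>M\<close> must have only finitely many factorisations, which holds
  for the two instances below. The grading comes from a degree function on \<open>M\<close>.\<close>

definition monomial_algebra ::
  "'m set \<Rightarrow> ('m \<Rightarrow> 'm \<Rightarrow> 'm) \<Rightarrow> ('m \<Rightarrow> int) \<Rightarrow> ('k::comm_ring_1, 'm \<Rightarrow> 'k) graded_algebra"
  where "monomial_algebra M mul deg =
    \<lparr>carrier = {f. finite {m. f m \<noteq> 0} \<and> {m. f m \<noteq> 0} \<subseteq> M},
     mult = (\<lambda>f g m. \<Sum>(u, v) | mul u v = m. f u * g v),
     one = undefined, zero = (\<lambda>m. 0), add = (\<lambda>f g m. f m + g m), smult = (\<lambda>c f m. c * f m),
     grade = (\<lambda>k. {f. finite {m. f m \<noteq> 0} \<and> {m. f m \<noteq> 0} \<subseteq> {m \<in> M. deg m = k}})\<rparr>"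

definition monomial :: "'m \<Rightarrow> 'm \<Rightarrow> 'k::comm_ring_1"
  where "monomial m = (\<lambda>m'. if m' = m then 1 else 0)"

text \<open>A polarized set is a pair of disjoint sets \<open>Xp\<close> and \<open>Xm\<close> of variables.\<close>

definition sign_degree :: "'x set \<Rightarrow> 'x \<Rightarrow> int"
  where "sign_degree Xp x = (if x \<in> Xp then 1 else -1)"


subsection \<open>The free 3-graded Lie algebra\<close>

datatype 'x magma = Gen 'x | Op "'x magma" "'x magma"

primrec magma_degree :: "'x set \<Rightarrow> 'x magma \<Rightarrow> int"
  where
    "magma_degree Xp (Gen x) = sign_degree Xp x"
  | "magma_degree Xp (Op s t) = magma_degree Xp s + magma_degree Xp t"

definition free_nonassoc ::
  "'x set \<Rightarrow> 'x set \<Rightarrow> ('k::comm_ring_1, 'x magma \<Rightarrow> 'k) graded_algebra"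
  where "free_nonassoc Xp Xm =
    monomial_algebra {t. set_magma t \<subseteq> Xp \<union> Xm} Op (magma_degree Xp)"

text \<open>Besides the Lie identities, all monomials of degree outside \<open>{-1, 0, 1}\<close> are killed.\<close>

definition lie_relations :: "'x set \<Rightarrow> 'x set \<Rightarrow> ('x magma \<Rightarrow> 'k::comm_ring_1) set"
  where "lie_relations Xp Xm = (let A = free_nonassoc Xp Xm in
    {a \<otimes>\<^bsub>A\<^esub> a | a. a \<in> carrier A} \<union>
    {(a \<otimes>\<^bsub>A\<^esub> b) \<otimes>\<^bsub>A\<^esub> c \<oplus>\<^bsub>A\<^esub> (b \<otimes>\<^bsub>A\<^esub> c) \<otimes>\<^bsub>A\<^esub> a \<oplus>\<^bsub>A\<^esub> (c \<otimes>\<^bsub>A\<^esub> a) \<otimes>\<^bsub>A\<^esub> b | a b c.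
       a \<in> carrier A \<and> b \<in> carrier A \<and> c \<in> carrier A} \<union>
    {monomial t | t. set_magma t \<subseteq> Xp \<union> Xm \<and> magma_degree Xp t \<notin> {-1, 0, 1}})"

definition lie_ideal :: "'x set \<Rightarrow> 'x set \<Rightarrow> ('x magma \<Rightarrow> 'k::comm_ring_1) set"
  where "lie_ideal Xp Xm = algebra_ideal (free_nonassoc Xp Xm) hull lie_relations Xp Xm"

definition free_lie ::
  "'x set \<Rightarrow> 'x set \<Rightarrow> ('k::comm_ring_1, ('x magma \<Rightarrow> 'k) set) graded_algebra"
  where "free_lie Xp Xm = quotient_algebra (free_nonassoc Xp Xm) (lie_ideal Xp Xm)"

definition lie_gen :: "'x set \<Rightarrow> 'x set \<Rightarrow> 'x \<Rightarrow> ('x magma \<Rightarrow> 'k::comm_ring_1) set"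
  where "lie_gen Xp Xm x = lie_ideal Xp Xm +>\<^bsub>free_nonassoc Xp Xm\<^esub> monomial (Gen x)"

definition polarized_maps ::
  "'x set \<Rightarrow> 'x set \<Rightarrow> ('k::comm_ring_1, 'l, 'm) graded_algebra_scheme \<Rightarrow> ('x \<Rightarrow> 'l) set"
  where "polarized_maps Xp Xm G = {\<phi>. \<phi> ` Xp \<subseteq> grade G 1 \<and> \<phi> ` Xm \<subseteq> grade G (-1)}"

definition extends_to_hom ::
  "'x set \<Rightarrow> 'x set \<Rightarrow> ('k::comm_ring_1, 'l, 'm) graded_algebra_scheme \<Rightarrow> ('x \<Rightarrow> 'l)
    \<Rightarrow> (('x magma \<Rightarrow> 'k) set \<Rightarrow> 'l) \<Rightarrow> bool"
  where "extends_to_hom Xp Xm G \<phi> h \<longleftrightarrow>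
    h \<in> graded_hom (free_lie Xp Xm) G \<and> (\<forall>x \<in> Xp \<union> Xm. h (lie_gen Xp Xm x) = \<phi> x)"

definition extension ::
  "'x set \<Rightarrow> 'x set \<Rightarrow> ('k::comm_ring_1, 'l, 'm) graded_algebra_scheme \<Rightarrow> ('x \<Rightarrow> 'l)
    \<Rightarrow> ('x magma \<Rightarrow> 'k) set \<Rightarrow> 'l"
  where "extension Xp Xm G \<phi> = (THE h. extends_to_hom Xp Xm G \<phi> h)"

definition is_identity ::
  "'x set \<Rightarrow> 'x set \<Rightarrow> ('x magma \<Rightarrow> 'k::comm_ring_1) set
    \<Rightarrow> ('k, 'l, 'm) graded_algebra_scheme \<Rightarrow> bool"
  where "is_identity Xp Xm f G \<longleftrightarrow>
    (\<forall>\<phi> \<in> polarized_maps Xp Xm G. extension Xp Xm G \<phi> f = \<zero>\<^bsub>G\<^esub>)"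


subsection \<open>The free 3-graded associative algebra\<close>

definition free_assoc ::
  "'x set \<Rightarrow> 'x set \<Rightarrow> ('k::comm_ring_1, 'x list \<Rightarrow> 'k) graded_algebra"
  where "free_assoc Xp Xm =
    monomial_algebra (lists (Xp \<union> Xm)) (@) (\<lambda>w. sum_list (map (sign_degree Xp) w))"

definition assoc_ideal :: "'x set \<Rightarrow> 'x set \<Rightarrow> ('x list \<Rightarrow> 'k::comm_ring_1) set"
  where "assoc_ideal Xp Xm = algebra_ideal (free_assoc Xp Xm) hull
    ({monomial [x, y] | x y. x \<in> Xp \<and> y \<in> Xp} \<union> {monomial [x, y] | x y. x \<in> Xm \<and> y \<in> Xm})"

definition Ass ::
  "'x set \<Rightarrow> 'x set \<Rightarrow> ('k::comm_ring_1, ('x list \<Rightarrow> 'k) set) graded_algebra"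
  where "Ass Xp Xm = quotient_algebra (free_assoc Xp Xm) (assoc_ideal Xp Xm)"

definition assoc_gen :: "'x set \<Rightarrow> 'x set \<Rightarrow> 'x \<Rightarrow> ('x list \<Rightarrow> 'k::comm_ring_1) set"
  where "assoc_gen Xp Xm x = assoc_ideal Xp Xm +>\<^bsub>free_assoc Xp Xm\<^esub> monomial [x]"

definition SL ::
  "'x set \<Rightarrow> 'x set \<Rightarrow> ('k::comm_ring_1, ('x list \<Rightarrow> 'k) set) graded_algebra"
  where "SL Xp Xm =
    generated_subalgebra (commutator_algebra (Ass Xp Xm)) (assoc_gen Xp Xm ` (Xp \<union> Xm))"

definition special_proj ::
  "'x set \<Rightarrow> 'x set \<Rightarrow> ('x magma \<Rightarrow> 'k::comm_ring_1) set \<Rightarrow> ('x list \<Rightarrow> 'k) set"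
  where "special_proj Xp Xm = extension Xp Xm (SL Xp Xm) (assoc_gen Xp Xm)"

text \<open>Modulo the defining relations of \<open>Ass\<close> the words of alternating sign form a basis, so every
  coset contains exactly one polynomial supported on such words; degrees and coefficients of an
  element of \<open>Ass\<close> are those of this representative.\<close>

definition alternating_word :: "'x set \<Rightarrow> 'x list \<Rightarrow> bool"
  where "alternating_word Xp w \<longleftrightarrow> successively (\<lambda>x y. x \<in> Xp \<longleftrightarrow> y \<notin> Xp) w"

definition has_monic_leading_term :: "'x set \<Rightarrow> ('x list \<Rightarrow> 'k::comm_ring_1) set \<Rightarrow> bool"
  where "has_monic_leading_term Xp C \<longleftrightarrow>
    (\<exists>g \<in> C. (\<forall>w. g w \<noteq> 0 \<longrightarrow> alternating_word Xp w) \<and>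
      (\<exists>w. g w = 1 \<and> (\<forall>v. g v \<noteq> 0 \<longrightarrow> length v \<le> length w)))"

text \<open>``Monic'' is understood up to a unit of the ring of scalars. With the coefficient literally
  equal to \<open>1\<close>, an element such as \<open>3[x, y]\<close> over the rationals would not be essential although its
  image is nonzero, contrary to essential being the same as having nonzero image over a field.\<close>

definition essential :: "'x set \<Rightarrow> 'x set \<Rightarrow> ('x magma \<Rightarrow> 'k::comm_ring_1) set \<Rightarrow> bool"
  where "essential Xp Xm f \<longleftrightarrow>
    special_proj Xp Xm f \<noteq> \<zero>\<^bsub>SL Xp Xm\<^esub> \<and>
    (\<exists>u. u dvd 1 \<and> has_monic_leading_term Xp (u \<odot>\<^bsub>SL Xp Xm\<^esub> special_proj Xp Xm f))"


section \<open>The 3-graded Lie algebra \<open>sl(p+q)\<close>\<close>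

definition trace :: "'k::comm_ring_1 mat \<Rightarrow> 'k"
  where "trace A = (\<Sum>i < dim_row A. A $$ (i, i))"

definition sl :: "nat \<Rightarrow> nat \<Rightarrow> ('k::comm_ring_1, 'k mat) graded_algebra"
  where "sl p q =
    \<lparr>carrier = {A \<in> carrier_mat (p + q) (p + q). trace A = 0},
     mult = (\<lambda>A B. A * B - B * A), one = undefined,
     zero = 0\<^sub>m (p + q) (p + q), add = (+), smult = (\<cdot>\<^sub>m),
     grade = (\<lambda>k.
       if k = 1 then {four_block_mat (0\<^sub>m p p) B (0\<^sub>m q p) (0\<^sub>m q q) | B. B \<in> carrier_mat p q}
       else if k = -1 then {four_block_mat (0\<^sub>m p p) (0\<^sub>m p q) C (0\<^sub>m q q) | C. C \<in> carrier_mat q p}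
       else if k = 0 then {four_block_mat A (0\<^sub>m p q) (0\<^sub>m q p) D | A D.
         A \<in> carrier_mat p p \<and> D \<in> carrier_mat q q \<and> trace A + trace D = 0}
       else {0\<^sub>m (p + q) (p + q)})\<rparr>"

end

theory Submission
  imports Defs
begin

text \<open>
  Let the nonassociative polynomial \<open>F\<close> represent \<open>f\<close>. Replacing every product in \<open>F\<close> by a commutator of
  words turns \<open>F\<close> into an associative polynomial \<open>G = commutator_poly Xp Xm F\<close>, and \<open>\<pi>(f)\<close> is the coset
  of \<open>G\<close> modulo the ideal generated by the products of two variables of equal sign
  (\<open>special_proj_coset\<close>). So \<open>\<pi>(f) \<noteq> 0\<close> means that \<open>G\<close> lies outside this ideal.

  A polarized map \<open>\<phi>\<close> into \<open>sl(p+q)\<close> sends two variables of equal sign to matrices with product \<open>0\<close>,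
  because both matrices sit in the same off-diagonal block. Evaluating words by multiplying matrices
  therefore annihilates the ideal (\<open>assoc_ideal_kernel\<close>), and the value of \<open>f\<close> at \<open>\<phi>\<close> is the value of
  \<open>G\<close> (\<open>extension_sl_coset\<close>). Hence \<open>\<pi>(f) = 0\<close> makes \<open>f\<close> an identity of every \<open>sl(p+q)\<close>.

  Conversely, a word with two neighbouring letters of equal sign lies in the ideal, so a polynomial
  \<open>G\<close> outside the ideal has a nonzero coefficient at some word \<open>w = x\<^sub>1 \<dots> x\<^sub>n\<close> of alternating sign. View
  \<open>w\<close> as a directed path with vertices \<open>0, \<dots>, n\<close> whose edge from \<open>i - 1\<close> to \<open>i\<close> carries the label \<open>x\<^sub>i\<close>.
  Since the signs alternate, the vertices can be divided into two sides so that edges with label in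
  \<open>Xp\<close> lead from the first side to the second and edges with label in \<open>Xm\<close> lead back. Sending each
  variable to the adjacency matrix of the edges that it labels is thus a polarized map into
  \<open>sl((n+1)+(n+1))\<close>. The only walk from vertex \<open>0\<close> to vertex \<open>n\<close> spells \<open>w\<close>, so the corresponding entry
  of the value of \<open>G\<close> is the coefficient of \<open>w\<close> in \<open>G\<close> (\<open>eval_assoc_path_matrix\<close>), which is not \<open>0\<close>.

  Over a field, a nonzero \<open>\<pi>(f)\<close> becomes monic when it is divided by its coefficient at a longest
  alternating word (\<open>monic_multiple\<close>); so being essential is the same as \<open>\<pi>(f) \<noteq> 0\<close>.

  Both \<open>\<pi>\<close> and the evaluations in \<open>sl(p+q)\<close> are homomorphisms obtained from the universal property of
  the free 3-graded Lie algebra. They are computed by \<open>extension_coset\<close>: the extension of \<open>\<phi>\<close> maps the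
  coset of \<open>F\<close> to the linear combination of the monomials of \<open>F\<close> evaluated at \<open>\<phi>\<close>.
\<close>

section \<open>Submodules, ideals and subalgebras\<close>

text \<open>Negatives are obtained as \<open>(-1) \<odot> x\<close>, so the group axioms reduce to identities between sums and
  scalar multiples.\<close>

lemma nonassoc_algebraI:
  fixes A :: "('k::comm_ring_1, 'a, 'm) module_scheme" (structure)
  assumes "\<zero> \<in> carrier A"
    and "\<And>x y. \<lbrakk>x \<in> carrier A; y \<in> carrier A\<rbrakk> \<Longrightarrow> x \<oplus> y \<in> carrier A"
    and "\<And>c x. x \<in> carrier A \<Longrightarrow> c \<odot> x \<in> carrier A"
    and "\<And>x y. \<lbrakk>x \<in> carrier A; y \<in> carrier A\<rbrakk> \<Longrightarrow> x \<otimes> y \<in> carrier A"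
    and "\<And>x y z. \<lbrakk>x \<in> carrier A; y \<in> carrier A; z \<in> carrier A\<rbrakk> \<Longrightarrow> (x \<oplus> y) \<oplus> z = x \<oplus> (y \<oplus> z)"
    and "\<And>x y. \<lbrakk>x \<in> carrier A; y \<in> carrier A\<rbrakk> \<Longrightarrow> x \<oplus> y = y \<oplus> x"
    and "\<And>x. x \<in> carrier A \<Longrightarrow> \<zero> \<oplus> x = x"
    and zero_smult: "\<And>x. x \<in> carrier A \<Longrightarrow> 0 \<odot> x = \<zero>"
    and one_smult: "\<And>x. x \<in> carrier A \<Longrightarrow> 1 \<odot> x = x"
    and add_smult: "\<And>a b x. x \<in> carrier A \<Longrightarrow> (a + b) \<odot> x = a \<odot> x \<oplus> b \<odot> x"
    and "\<And>a x y. \<lbrakk>x \<in> carrier A; y \<in> carrier A\<rbrakk> \<Longrightarrow> a \<odot> (x \<oplus> y) = a \<odot> x \<oplus> a \<odot> y"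
    and "\<And>a b x. x \<in> carrier A \<Longrightarrow> (a * b) \<odot> x = a \<odot> (b \<odot> x)"
    and "\<And>x y z. \<lbrakk>x \<in> carrier A; y \<in> carrier A; z \<in> carrier A\<rbrakk> \<Longrightarrow> (x \<oplus> y) \<otimes> z = x \<otimes> z \<oplus> y \<otimes> z"
    and "\<And>x y z. \<lbrakk>x \<in> carrier A; y \<in> carrier A; z \<in> carrier A\<rbrakk> \<Longrightarrow> z \<otimes> (x \<oplus> y) = z \<otimes> x \<oplus> z \<otimes> y"
    and "\<And>c x y. \<lbrakk>x \<in> carrier A; y \<in> carrier A\<rbrakk> \<Longrightarrow> (c \<odot> x) \<otimes> y = c \<odot> (x \<otimes> y)"
    and "\<And>c x y. \<lbrakk>x \<in> carrier A; y \<in> carrier A\<rbrakk> \<Longrightarrow> x \<otimes> (c \<odot> y) = c \<odot> (x \<otimes> y)"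
  shows "nonassoc_algebra A"
proof -
  have "(-1) \<odot> x \<oplus> x = \<zero>" if "x \<in> carrier A" for x
    using add_smult[of x "-1" 1] zero_smult one_smult that by simp
  then have "\<exists>y \<in> carrier A. y \<oplus> x = \<zero>" if "x \<in> carrier A" for x
    using that assms(3) by blast
  then have "abelian_group A"
    using assms(1,2,5-7) by (intro abelian_groupI)
  then have "Module.module class_ring A"
    by (rule moduleI[OF class_cring.is_cring]) (simp_all add: assms(3,9-12))
  then show ?thesis
    by (rule nonassoc_algebra.intro) (rule nonassoc_algebra_axioms.intro; fact assms)
qed

context nonassoc_algebra
begin

lemma smult_carrier [simp, intro]: "x \<in> carrier A \<Longrightarrow> c \<odot> x \<in> carrier A"
  using smult_closed by simp

lemma add_smult: "x \<in> carrier A \<Longrightarrow> (a + b) \<odot> x = a \<odot> x \<oplus> b \<odot> x"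
  using smult_l_distr by simp

lemma smult_add: "\<lbrakk>x \<in> carrier A; y \<in> carrier A\<rbrakk> \<Longrightarrow> a \<odot> (x \<oplus> y) = a \<odot> x \<oplus> a \<odot> y"
  using smult_r_distr by simp

lemma smult_smult: "x \<in> carrier A \<Longrightarrow> a \<odot> (b \<odot> x) = (a * b) \<odot> x"
  using smult_assoc1 by simp

lemma one_smult [simp]: "x \<in> carrier A \<Longrightarrow> 1 \<odot> x = x"
  using smult_one by simp

lemma zero_smult [simp]: "x \<in> carrier A \<Longrightarrow> 0 \<odot> x = \<zero>"
  using smult_l_null by simp

lemma smult_zero [simp]: "c \<odot> \<zero> = \<zero>"
  using smult_r_null by simp

lemma neg_eq_smult: "x \<in> carrier A \<Longrightarrow> \<ominus> x = (-1) \<odot> x"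
  using add_smult[of x "-1" 1] by (intro minus_equality) auto

lemma minus_eq_smult: "y \<in> carrier A \<Longrightarrow> x \<ominus> y = x \<oplus> (-1) \<odot> y"
  by (simp add: a_minus_def neg_eq_smult)

lemma mult_zero_l [simp]: "x \<in> carrier A \<Longrightarrow> \<zero> \<otimes> x = \<zero>"
  using mult_smult_l[of x x 0] by (simp add: mult_closed)

lemma mult_zero_r [simp]: "x \<in> carrier A \<Longrightarrow> x \<otimes> \<zero> = \<zero>"
  using mult_smult_r[of x x 0] by (simp add: mult_closed)

lemma submodule_iff:
  "Module.submodule H class_ring A \<longleftrightarrow> H \<subseteq> carrier A \<and> \<zero> \<in> H \<and>
    (\<forall>x \<in> H. \<forall>y \<in> H. x \<oplus> y \<in> H) \<and> (\<forall>c. \<forall>x \<in> H. c \<odot> x \<in> H)" (is "_ \<longleftrightarrow> ?closed")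
proof
  assume H: "Module.submodule H class_ring A"
  obtain x where "x \<in> H"
    using submoduleE(2)[OF H] by auto
  moreover from this have "0 \<odot> x \<in> H" "x \<in> carrier A"
    using submoduleE(1,4)[OF H] by auto
  ultimately have "\<zero> \<in> H"
    by simp
  then show ?closed
    using submoduleE[OF H] by auto
next
  assume ?closed
  then show "Module.submodule H class_ring A"
    by (intro submoduleI) (auto simp: neg_eq_smult subset_iff)
qed

lemma submodule_minus:
  "\<lbrakk>Module.submodule H class_ring A; x \<in> H; y \<in> H\<rbrakk> \<Longrightarrow> x \<ominus> y \<in> H"
  by (auto simp: submodule_iff minus_eq_smult subset_iff)

lemma algebra_ideal_carrier: "algebra_ideal A (carrier A)"
  by (simp add: algebra_ideal_def submodule_iff mult_closed)

text \<open>The carrier is in general smaller than the type, so the empty intersection is not an ideal. A hull is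
  an ideal once the family that it intersects contains the carrier.\<close>

lemma algebra_ideal_Inter:
  assumes "F \<noteq> {}" "\<And>T. T \<in> F \<Longrightarrow> algebra_ideal A T"
  shows "algebra_ideal A (\<Inter>F)"
proof -
  have "T \<subseteq> carrier A" "\<zero> \<in> T" "\<And>x y. \<lbrakk>x \<in> T; y \<in> T\<rbrakk> \<Longrightarrow> x \<oplus> y \<in> T" "\<And>c x. x \<in> T \<Longrightarrow> c \<odot> x \<in> T"
    "\<And>x y. \<lbrakk>x \<in> carrier A; y \<in> T\<rbrakk> \<Longrightarrow> x \<otimes> y \<in> T" "\<And>x y. \<lbrakk>x \<in> carrier A; y \<in> T\<rbrakk> \<Longrightarrow> y \<otimes> x \<in> T"
    if "T \<in> F" for T
    using assms(2)[OF that] unfolding algebra_ideal_def submodule_iff by blast+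
  note T = this
  have "\<Inter>F \<subseteq> carrier A"
    using assms(1) T(1) by blast
  then show ?thesis
    unfolding algebra_ideal_def submodule_iff
    by (intro conjI ballI allI InterI) (simp_all add: T)
qed

lemma subalgebra_Inter:
  assumes "F \<noteq> {}" "\<And>T. T \<in> F \<Longrightarrow> subalgebra A T"
  shows "subalgebra A (\<Inter>F)"
proof -
  have "T \<subseteq> carrier A" "\<zero> \<in> T" "\<And>x y. \<lbrakk>x \<in> T; y \<in> T\<rbrakk> \<Longrightarrow> x \<oplus> y \<in> T" "\<And>c x. x \<in> T \<Longrightarrow> c \<odot> x \<in> T"
    "\<And>x y. \<lbrakk>x \<in> T; y \<in> T\<rbrakk> \<Longrightarrow> x \<otimes> y \<in> T"
    if "T \<in> F" for T
    using assms(2)[OF that] unfolding subalgebra_def submodule_iff by blast+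
  note T = this
  have "\<Inter>F \<subseteq> carrier A"
    using assms(1) T(1) by blast
  then show ?thesis
    unfolding subalgebra_def submodule_iff
    by (intro conjI ballI allI InterI) (simp_all add: T)
qed

lemma algebra_ideal_hull: "S \<subseteq> carrier A \<Longrightarrow> algebra_ideal A (algebra_ideal A hull S)"
  unfolding hull_def using algebra_ideal_carrier by (intro algebra_ideal_Inter) auto

lemma subalgebra_carrier: "subalgebra A (carrier A)"
  by (simp add: subalgebra_def submodule_iff mult_closed)

lemma subalgebra_hull: "S \<subseteq> carrier A \<Longrightarrow> subalgebra A (subalgebra A hull S)"
  unfolding hull_def using subalgebra_carrier by (intro subalgebra_Inter) auto

end

section \<open>Homomorphisms\<close>

definition linear_on ::
  "('k::comm_ring_1, 'a, 'm) module_scheme \<Rightarrow> ('k, 'b, 'n) module_scheme \<Rightarrow> ('a \<Rightarrow> 'b) \<Rightarrow> bool"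
  where "linear_on A B h \<longleftrightarrow> (\<forall>x \<in> carrier A. h x \<in> carrier B) \<and>
    (\<forall>x \<in> carrier A. \<forall>y \<in> carrier A. h (x \<oplus>\<^bsub>A\<^esub> y) = h x \<oplus>\<^bsub>B\<^esub> h y) \<and>
    (\<forall>c. \<forall>x \<in> carrier A. h (c \<odot>\<^bsub>A\<^esub> x) = c \<odot>\<^bsub>B\<^esub> h x)"

definition algebra_hom ::
  "('k::comm_ring_1, 'a, 'm) module_scheme \<Rightarrow> ('k, 'b, 'n) module_scheme \<Rightarrow> ('a \<Rightarrow> 'b) \<Rightarrow> bool"
  where "algebra_hom A B h \<longleftrightarrow> linear_on A B h \<and>
    (\<forall>x \<in> carrier A. \<forall>y \<in> carrier A. h (x \<otimes>\<^bsub>A\<^esub> y) = h x \<otimes>\<^bsub>B\<^esub> h y)"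

lemma linear_onD:
  assumes "linear_on A B h"
  shows "x \<in> carrier A \<Longrightarrow> h x \<in> carrier B"
    and "\<lbrakk>x \<in> carrier A; y \<in> carrier A\<rbrakk> \<Longrightarrow> h (x \<oplus>\<^bsub>A\<^esub> y) = h x \<oplus>\<^bsub>B\<^esub> h y"
    and "x \<in> carrier A \<Longrightarrow> h (c \<odot>\<^bsub>A\<^esub> x) = c \<odot>\<^bsub>B\<^esub> h x"
  using assms by (auto simp: linear_on_def)

lemma algebra_homD:
  assumes "algebra_hom A B h"
  shows "linear_on A B h"
    and "x \<in> carrier A \<Longrightarrow> h x \<in> carrier B"
    and "\<lbrakk>x \<in> carrier A; y \<in> carrier A\<rbrakk> \<Longrightarrow> h (x \<oplus>\<^bsub>A\<^esub> y) = h x \<oplus>\<^bsub>B\<^esub> h y"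
    and "x \<in> carrier A \<Longrightarrow> h (c \<odot>\<^bsub>A\<^esub> x) = c \<odot>\<^bsub>B\<^esub> h x"
    and "\<lbrakk>x \<in> carrier A; y \<in> carrier A\<rbrakk> \<Longrightarrow> h (x \<otimes>\<^bsub>A\<^esub> y) = h x \<otimes>\<^bsub>B\<^esub> h y"
  using assms by (auto simp: algebra_hom_def linear_on_def)

lemma linear_on_zero:
  assumes "nonassoc_algebra A" "nonassoc_algebra B" "linear_on A B h"
  shows "h \<zero>\<^bsub>A\<^esub> = \<zero>\<^bsub>B\<^esub>"
proof -
  interpret A: nonassoc_algebra A by fact
  interpret B: nonassoc_algebra B by fact
  have "h (0 \<odot>\<^bsub>A\<^esub> \<zero>\<^bsub>A\<^esub>) = 0 \<odot>\<^bsub>B\<^esub> h \<zero>\<^bsub>A\<^esub>" "h \<zero>\<^bsub>A\<^esub> \<in> carrier B"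
    using linear_onD[OF assms(3)] by blast+
  then show ?thesis
    by simp
qed

lemma linear_on_minus:
  assumes "nonassoc_algebra A" "nonassoc_algebra B" "linear_on A B h"
    and "x \<in> carrier A" "y \<in> carrier A"
  shows "h (x \<ominus>\<^bsub>A\<^esub> y) = h x \<ominus>\<^bsub>B\<^esub> h y"
proof -
  interpret A: nonassoc_algebra A by fact
  interpret B: nonassoc_algebra B by fact
  show ?thesis
    using assms(4,5) by (simp add: A.minus_eq_smult B.minus_eq_smult linear_onD[OF assms(3)])
qed

lemma algebra_hom_comp: "\<lbrakk>algebra_hom A B h; algebra_hom B C g\<rbrakk> \<Longrightarrow> algebra_hom A C (\<lambda>x. g (h x))"
  by (simp add: algebra_hom_def linear_on_def)

lemma algebra_ideal_kernel:
  assumes "nonassoc_algebra A" "nonassoc_algebra B" "algebra_hom A B h"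
  shows "algebra_ideal A {x \<in> carrier A. h x = \<zero>\<^bsub>B\<^esub>}"
proof -
  interpret A: nonassoc_algebra A by fact
  interpret B: nonassoc_algebra B by fact
  note h = algebra_homD[OF assms(3)]
  show ?thesis
    unfolding algebra_ideal_def A.submodule_iff
    by (auto simp: h linear_on_zero[OF assms(1,2) h(1)] A.mult_closed)
qed

section \<open>Quotients by ideals\<close>

lemma quotient_algebra_sel:
  "carrier (quotient_algebra A I) = (\<lambda>x. I +>\<^bsub>A\<^esub> x) ` carrier A"
  "\<zero>\<^bsub>quotient_algebra A I\<^esub> = I"
  "grade (quotient_algebra A I) k = (\<lambda>x. I +>\<^bsub>A\<^esub> x) ` grade A k"
  by (auto simp: quotient_algebra_def A_RCOSETS_defs a_r_coset_def r_coset_def)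

context
  fixes A :: "('k::comm_ring_1, 'a) graded_algebra" (structure) and I
  assumes A: "nonassoc_algebra A" and I: "algebra_ideal A I"
begin

interpretation nonassoc_algebra A by (rule A)

lemma ideal_subset: "I \<subseteq> carrier A"
  and ideal_zero: "\<zero> \<in> I"
  and ideal_add: "\<lbrakk>x \<in> I; y \<in> I\<rbrakk> \<Longrightarrow> x \<oplus> y \<in> I"
  and ideal_smult: "x \<in> I \<Longrightarrow> c \<odot> x \<in> I"
  and ideal_mult: "\<lbrakk>x \<in> carrier A; y \<in> I\<rbrakk> \<Longrightarrow> x \<otimes> y \<in> I" "\<lbrakk>x \<in> carrier A; y \<in> I\<rbrakk> \<Longrightarrow> y \<otimes> x \<in> I"
  using I by (auto simp: algebra_ideal_def submodule_iff)

lemma ideal_abelian_subgroup: "abelian_subgroup I A"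
proof (rule abelian_subgroupI3)
  show "additive_subgroup I A"
    using I unfolding algebra_ideal_def Module.submodule_def by (intro additive_subgroup.intro) blast
qed unfold_locales

interpretation abelian_subgroup I A by (rule ideal_abelian_subgroup)

lemma coset_eq_iff:
  assumes "x \<in> carrier A" "y \<in> carrier A"
  shows "I +> x = I +> y \<longleftrightarrow> x \<ominus> y \<in> I"
proof -
  have "x \<ominus> y \<in> I \<longleftrightarrow> x \<in> I +> y"
    using a_rcos_module[of y x] assms by (simp add: a_minus_def)
  then show ?thesis
    using assms a_repr_independence' a_rcos_self by metis
qed

lemma coset_eq_zero_iff: "x \<in> carrier A \<Longrightarrow> I +> x = I \<longleftrightarrow> x \<in> I"
  using a_rcos_self[of x] a_rcos_const[of x] by blast

lemma quotient_add:
  "\<lbrakk>x \<in> carrier A; y \<in> carrier A\<rbrakk>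
    \<Longrightarrow> (I +> x) \<oplus>\<^bsub>quotient_algebra A I\<^esub> (I +> y) = I +> (x \<oplus> y)"
  by (simp add: quotient_algebra_def a_rcos_sum)

lemma in_coset_iff: "x \<in> carrier A \<Longrightarrow> y \<in> I +> x \<longleftrightarrow> (\<exists>i \<in> I. y = i \<oplus> x)"
  by (auto simp: a_r_coset_def r_coset_def)

lemma coset_add_ideal: "\<lbrakk>x \<in> carrier A; i \<in> I\<rbrakk> \<Longrightarrow> I +> (i \<oplus> x) = I +> x"
  using a_repr_independence'[of "i \<oplus> x" x] in_coset_iff[of x "i \<oplus> x"] by blast

lemma quotient_smult:
  assumes x: "x \<in> carrier A"
  shows "c \<odot>\<^bsub>quotient_algebra A I\<^esub> (I +> x) = I +> (c \<odot> x)"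
proof -
  have "I +> (c \<odot> y) = I +> (c \<odot> x)" if "y \<in> I +> x" for y
    using that x ideal_subset
    by (auto simp: in_coset_iff smult_add coset_add_ideal ideal_smult subset_iff)
  moreover have "x \<in> I +> x"
    using x by (rule a_rcos_self)
  ultimately have "(\<Union>y \<in> I +> x. I +> (c \<odot> y)) = I +> (c \<odot> x)"
    by blast
  then show ?thesis
    by (simp add: quotient_algebra_def)
qed

lemma quotient_mult:
  assumes x: "x \<in> carrier A" and y: "y \<in> carrier A"
  shows "(I +> x) \<otimes>\<^bsub>quotient_algebra A I\<^esub> (I +> y) = I +> (x \<otimes> y)"
proof -
  have "I +> (a \<otimes> b) = I +> (x \<otimes> y)" if ab: "a \<in> I +> x" "b \<in> I +> y" for a b
  proof -
    obtain i where i: "i \<in> I" "a = i \<oplus> x"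
      using ab(1) in_coset_iff[OF x, of a] by auto
    obtain j where j: "j \<in> I" "b = j \<oplus> y"
      using ab(2) in_coset_iff[OF y, of b] by auto
    have carr: "i \<in> carrier A" "j \<in> carrier A"
      using i j ideal_subset by auto
    then have "a \<otimes> b = (i \<otimes> (j \<oplus> y) \<oplus> x \<otimes> j) \<oplus> x \<otimes> y"
      using x y by (simp add: i(2) j(2) mult_l_distr mult_r_distr mult_closed a_ac)
    moreover have "i \<otimes> (j \<oplus> y) \<oplus> x \<otimes> j \<in> I"
      using x y i j carr by (intro ideal_add ideal_mult) auto
    ultimately show ?thesis
      using x y by (simp add: coset_add_ideal mult_closed)
  qed
  moreover have "x \<in> I +> x" "y \<in> I +> y"
    using x y by (auto intro: a_rcos_self)
  ultimately have "(\<Union>a \<in> I +> x. \<Union>b \<in> I +> y. I +> (a \<otimes> b)) = I +> (x \<otimes> y)"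
    by blast
  then show ?thesis
    by (simp add: quotient_algebra_def rcoset_mult_def)
qed

lemma quotient_nonassoc_algebra: "nonassoc_algebra (quotient_algebra A I)"
proof -
  have zero: "\<zero>\<^bsub>quotient_algebra A I\<^esub> = I +> \<zero>"
    using coset_eq_zero_iff[of \<zero>] ideal_zero by (simp add: quotient_algebra_sel)
  show ?thesis
    by (rule nonassoc_algebraI)
      (auto simp: zero quotient_algebra_sel(1) quotient_add quotient_smult quotient_mult
        mult_closed a_ac add_smult smult_add smult_smult mult_l_distr mult_r_distr
        mult_smult_l mult_smult_r)
qed

lemma quotient_map_hom: "algebra_hom A (quotient_algebra A I) (\<lambda>x. I +> x)"
  by (simp add: algebra_hom_def linear_on_def quotient_algebra_sel(1) quotient_add quotient_smult
      quotient_mult)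

text \<open>The induced map is chosen extensional because homomorphisms out of the free Lie algebra are compared
  as extensional functions.\<close>

lemma factor_through_quotient:
  assumes "nonassoc_algebra B" "linear_on A B h" and ker: "\<And>x. x \<in> I \<Longrightarrow> h x = \<zero>\<^bsub>B\<^esub>"
  shows "\<exists>g \<in> extensional (carrier (quotient_algebra A I)). \<forall>x \<in> carrier A. g (I +> x) = h x"
proof -
  interpret B: nonassoc_algebra B by fact
  define Q where "Q = quotient_algebra A I"
  have eq: "h x = h y" if "x \<in> carrier A" "y \<in> carrier A" "I +> x = I +> y" for x y
  proof -
    have "x \<ominus> y \<in> I"
      using that coset_eq_iff[of x y] by simp
    then have "h x \<oplus>\<^bsub>B\<^esub> \<ominus>\<^bsub>B\<^esub> h y = \<zero>\<^bsub>B\<^esub>"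
      using linear_on_minus[OF A assms(1,2) that(1,2)] ker by (simp add: a_minus_def)
    then show ?thesis
      using that(1,2) linear_onD(1)[OF assms(2)] B.minus_equality[of "h x" "\<ominus>\<^bsub>B\<^esub> h y"] by simp
  qed
  define g where "g = (\<lambda>C \<in> carrier Q. h (SOME x. x \<in> carrier A \<and> I +> x = C))"
  have "g (I +> x) = h x" if "x \<in> carrier A" for x
  proof -
    let ?y = "SOME y. y \<in> carrier A \<and> I +> y = I +> x"
    have "?y \<in> carrier A \<and> I +> ?y = I +> x"
      using that by (intro someI[of "\<lambda>y. y \<in> carrier A \<and> I +> y = I +> x" x]) auto
    then have "h ?y = h x"
      using that by (intro eq) auto
    then show ?thesis
      using that by (simp add: g_def Q_def quotient_algebra_sel(1))
  qed
  moreover have "g \<in> extensional (carrier Q)"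
    by (simp add: g_def)
  ultimately show ?thesis
    by (auto simp: Q_def)
qed

end

section \<open>Algebras with a multiplicative basis\<close>

lemma finite_support_induct [consumes 2, case_names zero add]:
  fixes f :: "'m \<Rightarrow> 'k::comm_ring_1"
  assumes "finite {m. f m \<noteq> 0}" and "{m. f m \<noteq> 0} \<subseteq> S"
    and zero: "P (\<lambda>m. 0)"
    and add: "\<And>f c m. \<lbrakk>finite {m. f m \<noteq> 0}; {m. f m \<noteq> 0} \<subseteq> S; m \<in> S; P f\<rbrakk>
      \<Longrightarrow> P (\<lambda>n. f n + c * monomial m n)"
  shows "P f"
proof -
  have "P f" if "finite T" "T \<subseteq> S" "{m. f m \<noteq> 0} \<subseteq> T" for T f
    using that
  proof (induction T arbitrary: f rule: finite_induct)
    case empty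
    then have "f = (\<lambda>m. 0)"
      by auto
    then show ?case
      using zero by simp
  next
    case (insert m T)
    define g where "g = f(m := 0)"
    have g: "{n. g n \<noteq> 0} \<subseteq> T"
      using insert.prems by (auto simp: g_def)
    then have "P g"
      using insert by auto
    moreover have "finite {n. g n \<noteq> 0}"
      using g insert.hyps finite_subset by blast
    moreover have "{n. g n \<noteq> 0} \<subseteq> S" "m \<in> S"
      using g insert.prems by auto
    ultimately have "P (\<lambda>n. g n + f m * monomial m n)"
      using add by blast
    moreover have "(\<lambda>n. g n + f m * monomial m n) = f"
      by (auto simp: g_def monomial_def)
    ultimately show ?case
      by simp
  qed
  then show ?thesis
    using assms(1,2) by blast
qed

definition linear_extension ::
  "('k::comm_ring_1, 'b, 'n) module_scheme \<Rightarrow> ('m \<Rightarrow> 'b) \<Rightarrow> ('m \<Rightarrow> 'k) \<Rightarrow> 'b"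
  where "linear_extension B e f = (\<Oplus>\<^bsub>B\<^esub>m \<in> {m. f m \<noteq> 0}. f m \<odot>\<^bsub>B\<^esub> e m)"

text \<open>Finiteness of the set of factorisations makes the sum that defines the product of the free module
  bilinear; over an infinite index set it would be \<open>0\<close> by convention.\<close>

locale multiplicative_basis =
  fixes M :: "'m set" and mul :: "'m \<Rightarrow> 'm \<Rightarrow> 'm" and deg :: "'m \<Rightarrow> int"
  assumes mul_closed: "\<lbrakk>u \<in> M; v \<in> M\<rbrakk> \<Longrightarrow> mul u v \<in> M"
    and finite_factorisations: "finite {(u, v). mul u v = m}"
    and deg_mul: "\<lbrakk>u \<in> M; v \<in> M\<rbrakk> \<Longrightarrow> deg (mul u v) = deg u + deg v"
begin

abbreviation MA :: "('k::comm_ring_1, 'm \<Rightarrow> 'k) graded_algebra"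
  where "MA \<equiv> monomial_algebra M mul deg"

lemma MA_simps:
  "carrier MA = {f. finite {m. f m \<noteq> 0} \<and> {m. f m \<noteq> 0} \<subseteq> M}"
  "\<zero>\<^bsub>MA\<^esub> = (\<lambda>m. 0)" "f \<oplus>\<^bsub>MA\<^esub> g = (\<lambda>m. f m + g m)" "c \<odot>\<^bsub>MA\<^esub> f = (\<lambda>m. c * f m)"
  "f \<otimes>\<^bsub>MA\<^esub> g = (\<lambda>m. \<Sum>(u, v) | mul u v = m. f u * g v)"
  "grade MA k = {f. finite {m. f m \<noteq> 0} \<and> {m. f m \<noteq> 0} \<subseteq> {m \<in> M. deg m = k}}"
  by (auto simp: monomial_algebra_def)

lemma mult_support:
  fixes f g :: "'m \<Rightarrow> 'k::comm_ring_1"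
  shows "{m. (f \<otimes>\<^bsub>MA\<^esub> g) m \<noteq> 0} \<subseteq> (\<lambda>(u, v). mul u v) ` ({m. f m \<noteq> 0} \<times> {m. g m \<noteq> 0})"
proof
  fix m assume "m \<in> {m. (f \<otimes>\<^bsub>MA\<^esub> g) m \<noteq> 0}"
  then have "(\<Sum>(u, v) | mul u v = m. f u * g v) \<noteq> 0"
    by (simp add: MA_simps)
  then obtain p where "p \<in> {(u, v). mul u v = m}" "(case p of (u, v) \<Rightarrow> f u * g v) \<noteq> 0"
    by (rule sum.not_neutral_contains_not_neutral)
  then show "m \<in> (\<lambda>(u, v). mul u v) ` ({m. f m \<noteq> 0} \<times> {m. g m \<noteq> 0})"
    by (cases p) (auto intro!: image_eqI[of _ _ p])
qed

lemma mult_finite_support: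
  fixes f g :: "'m \<Rightarrow> 'k::comm_ring_1"
  assumes "finite {m. f m \<noteq> 0}" "finite {m. g m \<noteq> 0}"
  shows "finite {m. (f \<otimes>\<^bsub>MA\<^esub> g) m \<noteq> 0}"
  using mult_support by (rule finite_subset) (use assms in simp)

lemma add_finite_support:
  fixes f g :: "'m \<Rightarrow> 'k::comm_ring_1"
  assumes "finite {m. f m \<noteq> 0}" "finite {m. g m \<noteq> 0}"
  shows "finite {m. f m + g m \<noteq> 0}"
  by (rule finite_subset[of _ "{m. f m \<noteq> 0} \<union> {m. g m \<noteq> 0}"]) (use assms in auto)

lemma smult_finite_support:
  fixes f :: "'m \<Rightarrow> 'k::comm_ring_1"
  assumes "finite {m. f m \<noteq> 0}"
  shows "finite {m. c * f m \<noteq> 0}"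
  by (rule finite_subset[of _ "{m. f m \<noteq> 0}"]) (use assms in auto)

lemma mult_carrier:
  assumes "f \<in> carrier (MA :: ('k::comm_ring_1, _) graded_algebra)" "g \<in> carrier MA"
  shows "f \<otimes>\<^bsub>MA\<^esub> g \<in> carrier MA"
proof -
  have "finite {m. (f \<otimes>\<^bsub>MA\<^esub> g) m \<noteq> 0}"
    using assms by (intro mult_finite_support) (simp_all add: MA_simps(1))
  moreover have "{m. (f \<otimes>\<^bsub>MA\<^esub> g) m \<noteq> 0} \<subseteq> M"
    using assms mul_closed by (intro subset_trans[OF mult_support]) (auto simp: MA_simps(1))
  ultimately show ?thesis
    by (simp add: MA_simps(1))
qed

lemma grade_mult_MA:
  assumes "f \<in> grade (MA :: ('k::comm_ring_1, _) graded_algebra) i" "g \<in> grade MA j"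
  shows "f \<otimes>\<^bsub>MA\<^esub> g \<in> grade MA (i + j)"
proof -
  have "finite {m. (f \<otimes>\<^bsub>MA\<^esub> g) m \<noteq> 0}"
    using assms by (intro mult_finite_support) (simp_all add: MA_simps(6))
  moreover have "{m. (f \<otimes>\<^bsub>MA\<^esub> g) m \<noteq> 0} \<subseteq> {m \<in> M. deg m = i + j}"
    using assms mul_closed deg_mul
    by (intro subset_trans[OF mult_support]) (fastforce simp: MA_simps(6))
  ultimately show ?thesis
    by (simp add: MA_simps(6))
qed

lemma nonassoc_algebra_MA: "nonassoc_algebra (MA :: ('k::comm_ring_1, _) graded_algebra)"
proof (rule nonassoc_algebraI, goal_cases)
  case (2 x y)
  then have "finite {m. x m + y m \<noteq> 0}"
    by (intro add_finite_support) (auto simp: MA_simps(1))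
  moreover have "{m. x m + y m \<noteq> 0} \<subseteq> {m. x m \<noteq> 0} \<union> {m. y m \<noteq> 0}"
    by auto
  ultimately show ?case
    using 2 by (auto simp: MA_simps(1,3))
next
  case (3 c x)
  then have "finite {m. c * x m \<noteq> 0}"
    by (intro smult_finite_support) (auto simp: MA_simps(1))
  then show ?case
    using 3 by (auto simp: MA_simps(1,4))
next
  case 4
  then show ?case
    by (rule mult_carrier)
qed (auto simp: MA_simps fun_eq_iff algebra_simps sum.distrib sum_distrib_left split_def)

lemma submodule_grade_MA:
  "Module.submodule (grade (MA :: ('k::comm_ring_1, _) graded_algebra) k) class_ring MA"
proof -
  interpret nonassoc_algebra MA
    by (rule nonassoc_algebra_MA)
  have "f \<oplus>\<^bsub>MA\<^esub> g \<in> grade MA k" if "f \<in> grade MA k" "g \<in> grade MA k" for f g :: "'m \<Rightarrow> 'k"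
  proof -
    have "finite {m. f m + g m \<noteq> 0}"
      using that by (intro add_finite_support) (auto simp: MA_simps(6))
    moreover have "{m. f m + g m \<noteq> 0} \<subseteq> {m. f m \<noteq> 0} \<union> {m. g m \<noteq> 0}"
      by auto
    ultimately show ?thesis
      using that by (auto simp: MA_simps(3,6))
  qed
  moreover have "c \<odot>\<^bsub>MA\<^esub> f \<in> grade MA k" if "f \<in> grade MA k" for c and f :: "'m \<Rightarrow> 'k"
  proof -
    have "finite {m. c * f m \<noteq> 0}"
      using that by (intro smult_finite_support) (auto simp: MA_simps(6))
    moreover have "{m. c * f m \<noteq> 0} \<subseteq> {m. f m \<noteq> 0}"
      by auto
    ultimately show ?thesis
      using that by (auto simp: MA_simps(4,6))
  qed
  moreover have "grade MA k \<subseteq> (carrier MA :: ('m \<Rightarrow> 'k) set)" "\<zero>\<^bsub>MA\<^esub> \<in> (grade MA k :: ('m \<Rightarrow> 'k) set)"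
    by (auto simp: MA_simps)
  ultimately show ?thesis
    by (simp add: submodule_iff)
qed

lemma monomial_support: "{n. (monomial m n :: 'k::comm_ring_1) \<noteq> 0} = {m}"
  by (auto simp: monomial_def)

lemma monomial_carrier [simp]: "m \<in> M \<Longrightarrow> monomial m \<in> carrier MA"
  by (simp add: MA_simps monomial_support)

lemma monomial_grade: "m \<in> M \<Longrightarrow> monomial m \<in> grade MA (deg m)"
  by (simp add: MA_simps monomial_support)

lemma monomial_mult:
  "monomial u \<otimes>\<^bsub>MA\<^esub> monomial v = (monomial (mul u v) :: 'm \<Rightarrow> 'k::comm_ring_1)"
proof
  fix m
  have "(\<Sum>(u', v') | mul u' v' = m. monomial u u' * monomial v v' :: 'k) =
      (\<Sum>p | mul (fst p) (snd p) = m. if p = (u, v) then 1 else 0)"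
    by (intro sum.cong) (auto simp: monomial_def split: if_splits)
  also have "\<dots> = monomial (mul u v) m"
    using finite_factorisations[of m] by (auto simp: monomial_def split_def)
  finally show "(monomial u \<otimes>\<^bsub>MA\<^esub> monomial v) m = (monomial (mul u v) m :: 'k)"
    by (simp add: MA_simps)
qed

lemma submodule_spanned:
  assumes H: "Module.submodule H class_ring (MA :: ('k::comm_ring_1, _) graded_algebra)"
    and f: "f \<in> carrier MA" and supp: "\<And>m. \<lbrakk>m \<in> M; f m \<noteq> 0\<rbrakk> \<Longrightarrow> monomial m \<in> H"
  shows "f \<in> H"
proof -
  interpret nonassoc_algebra MA
    by (rule nonassoc_algebra_MA)
  have "finite {m. f m \<noteq> 0}" "{m. f m \<noteq> 0} \<subseteq> {m \<in> M. f m \<noteq> 0}"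
    using f by (auto simp: MA_simps)
  then show ?thesis
  proof (induction f rule: finite_support_induct)
    case zero
    then show ?case
      using H by (simp add: submodule_iff MA_simps(2))
  next
    case (add g c m)
    then have "g \<oplus>\<^bsub>MA\<^esub> c \<odot>\<^bsub>MA\<^esub> monomial m \<in> H"
      using H supp by (simp add: submodule_iff)
    then show ?case
      by (simp add: MA_simps)
  qed
qed

lemma linear_on_eqI:
  assumes B: "nonassoc_algebra (B :: ('k::comm_ring_1, 'b, 'n) module_scheme)"
    and h: "linear_on MA B h" and h': "linear_on MA B h'"
    and eq: "\<And>m. m \<in> M \<Longrightarrow> h (monomial m) = h' (monomial m)" and f: "f \<in> carrier MA"
  shows "h f = h' f"
proof -
  interpret nonassoc_algebra MA
    by (rule nonassoc_algebra_MA)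
  have "Module.submodule {f \<in> carrier MA. h f = h' f} class_ring MA"
    using linear_onD[OF h] linear_onD[OF h'] linear_on_zero[OF nonassoc_algebra_MA B h]
      linear_on_zero[OF nonassoc_algebra_MA B h']
    by (simp add: submodule_iff subset_iff)
  from submodule_spanned[OF this f] eq show ?thesis
    by simp
qed

context
  fixes B :: "('k::comm_ring_1, 'b, 'n) module_scheme" and e
  assumes B: "nonassoc_algebra B" and e: "\<And>m. m \<in> M \<Longrightarrow> e m \<in> carrier B"
begin

interpretation B: nonassoc_algebra B by (rule B)

text \<open>Padding with zero coefficients allows sums of several functions to be written over a common support.\<close>

lemma linear_extension_superset:
  assumes "finite S" "{m. f m \<noteq> 0} \<subseteq> S" "S \<subseteq> M"
  shows "linear_extension B e f = (\<Oplus>\<^bsub>B\<^esub>m \<in> S. f m \<odot>\<^bsub>B\<^esub> e m)"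
  unfolding linear_extension_def using assms e
  by (intro B.add.finprod_mono_neutral_cong_left) (auto simp: Pi_iff subset_iff)

lemma linear_on_linear_extension: "linear_on MA B (linear_extension B e)"
proof -
  have "linear_extension B e f \<in> carrier B" if "f \<in> carrier MA" for f
    unfolding linear_extension_def using that e by (intro B.finsum_closed) (auto simp: MA_simps)
  moreover have "linear_extension B e (f \<oplus>\<^bsub>MA\<^esub> g)
      = linear_extension B e f \<oplus>\<^bsub>B\<^esub> linear_extension B e g"
    if "f \<in> carrier MA" "g \<in> carrier MA" for f g
  proof -
    define S where "S = {m. f m \<noteq> 0} \<union> {m. g m \<noteq> 0}"
    have S: "finite S" "S \<subseteq> M" "{m. f m \<noteq> 0} \<subseteq> S" "{m. g m \<noteq> 0} \<subseteq> S" "{m. f m + g m \<noteq> 0} \<subseteq> S"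
      using that by (auto simp: S_def MA_simps)
    have eS: "m \<in> S \<Longrightarrow> e m \<in> carrier B" for m
      using S e by auto
    have "linear_extension B e (f \<oplus>\<^bsub>MA\<^esub> g) = (\<Oplus>\<^bsub>B\<^esub>m \<in> S. (f m + g m) \<odot>\<^bsub>B\<^esub> e m)"
      using S by (simp add: linear_extension_superset MA_simps)
    also have "\<dots> = (\<Oplus>\<^bsub>B\<^esub>m \<in> S. f m \<odot>\<^bsub>B\<^esub> e m \<oplus>\<^bsub>B\<^esub> g m \<odot>\<^bsub>B\<^esub> e m)"
      using eS by (intro B.finsum_cong') (auto simp: B.add_smult)
    also have "\<dots> = (\<Oplus>\<^bsub>B\<^esub>m \<in> S. f m \<odot>\<^bsub>B\<^esub> e m) \<oplus>\<^bsub>B\<^esub> (\<Oplus>\<^bsub>B\<^esub>m \<in> S. g m \<odot>\<^bsub>B\<^esub> e m)"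
      using eS by (intro B.finsum_addf) auto
    finally show ?thesis
      using S by (simp add: linear_extension_superset)
  qed
  moreover have "linear_extension B e (c \<odot>\<^bsub>MA\<^esub> f) = c \<odot>\<^bsub>B\<^esub> linear_extension B e f"
    if "f \<in> carrier MA" for c f
  proof -
    define S where "S = {m. f m \<noteq> 0}"
    have S: "finite S" "S \<subseteq> M" "{m. f m \<noteq> 0} \<subseteq> S" "{m. c * f m \<noteq> 0} \<subseteq> S"
      using that by (auto simp: S_def MA_simps)
    have eS: "m \<in> S \<Longrightarrow> e m \<in> carrier B" for m
      using S e by auto
    have "linear_extension B e (c \<odot>\<^bsub>MA\<^esub> f) = (\<Oplus>\<^bsub>B\<^esub>m \<in> S. (c * f m) \<odot>\<^bsub>B\<^esub> e m)"
      using S by (simp add: linear_extension_superset MA_simps)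
    also have "\<dots> = (\<Oplus>\<^bsub>B\<^esub>m \<in> S. c \<odot>\<^bsub>B\<^esub> (f m \<odot>\<^bsub>B\<^esub> e m))"
      using eS by (intro B.finsum_cong') (auto simp: B.smult_smult)
    also have "\<dots> = c \<odot>\<^bsub>B\<^esub> (\<Oplus>\<^bsub>B\<^esub>m \<in> S. f m \<odot>\<^bsub>B\<^esub> e m)"
      using eS S(1) by (intro B.finsum_smult_ldistr[symmetric]) auto
    finally show ?thesis
      using S by (simp add: linear_extension_superset)
  qed
  ultimately show ?thesis
    by (simp add: linear_on_def)
qed

lemma linear_extension_monomial: "m \<in> M \<Longrightarrow> linear_extension B e (monomial m) = e m"
  using linear_extension_superset[of "{m}" "monomial m"] e
  by (simp add: monomial_support) (simp add: monomial_def)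

lemma linear_extension_submodule:
  assumes H: "Module.submodule H class_ring B" and f: "f \<in> carrier MA"
    and supp: "\<And>m. \<lbrakk>m \<in> M; f m \<noteq> 0\<rbrakk> \<Longrightarrow> e m \<in> H"
  shows "linear_extension B e f \<in> H"
proof -
  interpret MA: nonassoc_algebra MA
    by (rule nonassoc_algebra_MA)
  have "Module.submodule {f \<in> carrier MA. linear_extension B e f \<in> H} class_ring MA"
    using H linear_onD[OF linear_on_linear_extension]
      linear_on_zero[OF nonassoc_algebra_MA B linear_on_linear_extension]
    by (simp add: MA.submodule_iff B.submodule_iff subset_iff)
  from submodule_spanned[OF this f] supp show ?thesis
    by (simp add: linear_extension_monomial)
qed

lemma algebra_hom_linear_extension:
  assumes mul: "\<And>u v. \<lbrakk>u \<in> M; v \<in> M\<rbrakk> \<Longrightarrow> e (mul u v) = e u \<otimes>\<^bsub>B\<^esub> e v"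
  shows "algebra_hom MA B (linear_extension B e)"
proof -
  interpret MA: nonassoc_algebra MA
    by (rule nonassoc_algebra_MA)
  let ?h = "linear_extension B e"
  note h = linear_onD[OF linear_on_linear_extension]
  \<comment> \<open>Both sides are bilinear: compare them on basis elements in the left factor, then in the right one.\<close>
  have mono: "?h (f \<otimes>\<^bsub>MA\<^esub> monomial v) = ?h f \<otimes>\<^bsub>B\<^esub> e v" if f: "f \<in> carrier MA" and v: "v \<in> M" for f v
  proof (rule linear_on_eqI[OF B _ _ _ f])
    show "linear_on MA B (\<lambda>f. ?h (f \<otimes>\<^bsub>MA\<^esub> monomial v))"
      using v h by (simp add: linear_on_def MA.mult_closed MA.mult_l_distr MA.mult_smult_l)
    show "linear_on MA B (\<lambda>f. ?h f \<otimes>\<^bsub>B\<^esub> e v)"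
      using v h e by (simp add: linear_on_def B.mult_closed B.mult_l_distr B.mult_smult_l)
  qed (use v in \<open>simp add: monomial_mult linear_extension_monomial mul_closed mul\<close>)
  have "?h (f \<otimes>\<^bsub>MA\<^esub> g) = ?h f \<otimes>\<^bsub>B\<^esub> ?h g" if f: "f \<in> carrier MA" and g: "g \<in> carrier MA" for f g
  proof (rule linear_on_eqI[OF B _ _ _ g])
    show "linear_on MA B (\<lambda>g. ?h (f \<otimes>\<^bsub>MA\<^esub> g))"
      using f h by (simp add: linear_on_def MA.mult_closed MA.mult_r_distr MA.mult_smult_r)
    show "linear_on MA B (\<lambda>g. ?h f \<otimes>\<^bsub>B\<^esub> ?h g)"
      using f h by (simp add: linear_on_def B.mult_closed B.mult_r_distr B.mult_smult_r)
  qed (use f in \<open>simp add: mono linear_extension_monomial\<close>)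
  then show ?thesis
    using linear_on_linear_extension by (simp add: algebra_hom_def)
qed

end

lemma MA_assoc:
  assumes assoc: "\<And>u v w. mul (mul u v) w = mul u (mul v w)"
    and f: "f \<in> carrier (MA :: ('k::comm_ring_1, _) graded_algebra)"
    and g: "g \<in> carrier MA" and h: "h \<in> carrier MA"
  shows "(f \<otimes>\<^bsub>MA\<^esub> g) \<otimes>\<^bsub>MA\<^esub> h = f \<otimes>\<^bsub>MA\<^esub> (g \<otimes>\<^bsub>MA\<^esub> h)"
proof -
  interpret nonassoc_algebra MA
    by (rule nonassoc_algebra_MA)
  note lin = linear_on_def mult_closed mult_l_distr mult_r_distr mult_smult_l mult_smult_r
  note eqI = linear_on_eqI[OF nonassoc_algebra_MA]
  have 1: "(f \<otimes>\<^bsub>MA\<^esub> monomial v) \<otimes>\<^bsub>MA\<^esub> monomial w = f \<otimes>\<^bsub>MA\<^esub> (monomial v \<otimes>\<^bsub>MA\<^esub> monomial w)"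
    if "v \<in> M" "w \<in> M" for v w
    by (rule eqI[of "\<lambda>f. (f \<otimes>\<^bsub>MA\<^esub> monomial v) \<otimes>\<^bsub>MA\<^esub> monomial w" _ f])
      (use that f in \<open>simp_all add: lin monomial_mult assoc mul_closed\<close>)
  have 2: "(f \<otimes>\<^bsub>MA\<^esub> g) \<otimes>\<^bsub>MA\<^esub> monomial w = f \<otimes>\<^bsub>MA\<^esub> (g \<otimes>\<^bsub>MA\<^esub> monomial w)" if "w \<in> M" for w
    by (rule eqI[of "\<lambda>g. (f \<otimes>\<^bsub>MA\<^esub> g) \<otimes>\<^bsub>MA\<^esub> monomial w" _ g])
      (use that f g 1 in \<open>simp_all add: lin\<close>)
  show ?thesis
    by (rule eqI[of "\<lambda>h. (f \<otimes>\<^bsub>MA\<^esub> g) \<otimes>\<^bsub>MA\<^esub> h" _ h]) (use f g h 2 in \<open>simp_all add: lin\<close>)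
qed

end

section \<open>Lie algebras of commutators\<close>

text \<open>The operations have to agree on the smaller carrier only: the bracket of \<open>sl(p+q)\<close> and the commutator
  of the algebra of matrices are different functions on matrices of other sizes.\<close>

lemma lie_algebra_restrict:
  fixes A :: "('k::comm_ring_1, 'a, 'm) module_scheme" and B :: "('k, 'a, 'n) module_scheme"
  assumes B: "lie_algebra B" and sub: "subalgebra B (carrier A)" and zero: "\<zero>\<^bsub>A\<^esub> = \<zero>\<^bsub>B\<^esub>"
    and add: "\<And>x y. \<lbrakk>x \<in> carrier A; y \<in> carrier A\<rbrakk> \<Longrightarrow> x \<oplus>\<^bsub>A\<^esub> y = x \<oplus>\<^bsub>B\<^esub> y"
    and smult: "\<And>c x. x \<in> carrier A \<Longrightarrow> c \<odot>\<^bsub>A\<^esub> x = c \<odot>\<^bsub>B\<^esub> x"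
    and mult: "\<And>x y. \<lbrakk>x \<in> carrier A; y \<in> carrier A\<rbrakk> \<Longrightarrow> x \<otimes>\<^bsub>A\<^esub> y = x \<otimes>\<^bsub>B\<^esub> y"
  shows "lie_algebra A"
proof -
  interpret B: lie_algebra B by (rule B)
  have A: "x \<in> carrier B" if "x \<in> carrier A" for x
    using that sub by (auto simp: subalgebra_def B.submodule_iff)
  have closed: "\<zero>\<^bsub>B\<^esub> \<in> carrier A" "\<lbrakk>x \<in> carrier A; y \<in> carrier A\<rbrakk> \<Longrightarrow> x \<oplus>\<^bsub>B\<^esub> y \<in> carrier A"
    "x \<in> carrier A \<Longrightarrow> c \<odot>\<^bsub>B\<^esub> x \<in> carrier A"
    "\<lbrakk>x \<in> carrier A; y \<in> carrier A\<rbrakk> \<Longrightarrow> x \<otimes>\<^bsub>B\<^esub> y \<in> carrier A" for x y c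
    using sub by (auto simp: subalgebra_def B.submodule_iff)
  have "nonassoc_algebra A"
    by (rule nonassoc_algebraI)
      (simp_all add: closed zero add smult mult A B.add_smult B.smult_add B.smult_smult
        B.mult_l_distr B.mult_r_distr B.mult_smult_l B.mult_smult_r B.a_ac)
  moreover have "lie_algebra_axioms A"
    by (rule lie_algebra_axioms.intro) (simp_all add: closed zero add mult A B.alternating B.jacobi)
  ultimately show ?thesis
    by (rule lie_algebra.intro)
qed

lemma commutator_algebra_sel [simp]:
  "carrier (commutator_algebra A) = carrier A" "\<zero>\<^bsub>commutator_algebra A\<^esub> = \<zero>\<^bsub>A\<^esub>"
  "add (commutator_algebra A) = add A" "smult (commutator_algebra A) = smult A"
  "x \<otimes>\<^bsub>commutator_algebra A\<^esub> y = x \<otimes>\<^bsub>A\<^esub> y \<ominus>\<^bsub>A\<^esub> y \<otimes>\<^bsub>A\<^esub> x"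
  "grade (commutator_algebra A) k = grade A k"
  by (simp_all add: commutator_algebra_def)

context nonassoc_algebra
begin

lemma minus_add_cancel: "\<lbrakk>x \<in> carrier A; y \<in> carrier A\<rbrakk> \<Longrightarrow> (x \<ominus> y) \<oplus> y = x"
  by (simp add: a_minus_def a_assoc l_neg)

text \<open>The Jacobi identity for commutators: with \<open>a = xyz\<close>, \<open>b = yxz\<close>, \<open>c = zxy\<close>, \<open>d = zyx\<close>, \<open>e = yzx\<close> and
  \<open>f = xzy\<close> the three summands are the double commutators, in which every product occurs once with
  each sign.\<close>

lemma cyclic_sum_zero:
  assumes "a \<in> carrier A" "b \<in> carrier A" "c \<in> carrier A" "d \<in> carrier A" "e \<in> carrier A" "f \<in> carrier A"
  shows "((a \<ominus> b) \<ominus> (c \<ominus> d)) \<oplus> ((e \<ominus> d) \<ominus> (a \<ominus> f)) \<oplus> ((c \<ominus> f) \<ominus> (e \<ominus> b)) = \<zero>"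
proof -
  have U: "((p \<ominus> q) \<ominus> (r \<ominus> s)) \<oplus> (q \<oplus> r) = p \<oplus> s"
    if "p \<in> carrier A" "q \<in> carrier A" "r \<in> carrier A" "s \<in> carrier A" for p q r s
  proof -
    have "((p \<ominus> q) \<ominus> (r \<ominus> s)) \<oplus> (q \<oplus> r) = ((p \<ominus> q) \<ominus> (r \<ominus> s)) \<oplus> (q \<oplus> ((r \<ominus> s) \<oplus> s))"
      using that by (simp add: minus_add_cancel)
    also have "\<dots> = ((((p \<ominus> q) \<ominus> (r \<ominus> s)) \<oplus> (r \<ominus> s)) \<oplus> q) \<oplus> s"
      using that by (simp add: a_ac)
    also have "\<dots> = p \<oplus> s"
      using that by (simp add: minus_add_cancel)
    finally show ?thesis .
  qed
  define u v w where "u = (a \<ominus> b) \<ominus> (c \<ominus> d)" and "v = (e \<ominus> d) \<ominus> (a \<ominus> f)" and "w = (c \<ominus> f) \<ominus> (e \<ominus> b)"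
  \<comment> \<open>The sum of all terms with a negative sign; after it is added, only the positive terms remain.\<close>
  define s where "s = b \<oplus> c \<oplus> (d \<oplus> a) \<oplus> (f \<oplus> e)"
  have carr: "u \<in> carrier A" "v \<in> carrier A" "w \<in> carrier A" "s \<in> carrier A"
    using assms by (simp_all add: u_def v_def w_def s_def)
  have "(u \<oplus> v \<oplus> w) \<oplus> s = (u \<oplus> (b \<oplus> c)) \<oplus> (v \<oplus> (d \<oplus> a)) \<oplus> (w \<oplus> (f \<oplus> e))"
    using assms carr by (simp add: s_def a_ac)
  also have "\<dots> = (a \<oplus> d) \<oplus> (e \<oplus> f) \<oplus> (c \<oplus> b)"
    using assms by (simp add: u_def v_def w_def U)
  also have "\<dots> = s"
    using assms by (simp add: s_def a_ac)
  finally have "u \<oplus> v \<oplus> w = \<zero>"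
    using carr by (simp add: add.r_cancel_one)
  then show ?thesis
    by (simp add: u_def v_def w_def)
qed

lemma mult_minus_l:
  "\<lbrakk>x \<in> carrier A; y \<in> carrier A; z \<in> carrier A\<rbrakk> \<Longrightarrow> (x \<ominus> y) \<otimes> z = x \<otimes> z \<ominus> y \<otimes> z"
  by (simp add: minus_eq_smult mult_l_distr mult_smult_l mult_closed)

lemma mult_minus_r:
  "\<lbrakk>x \<in> carrier A; y \<in> carrier A; z \<in> carrier A\<rbrakk> \<Longrightarrow> z \<otimes> (x \<ominus> y) = z \<otimes> x \<ominus> z \<otimes> y"
  by (simp add: minus_eq_smult mult_r_distr mult_smult_r mult_closed)

end

lemma lie_algebra_commutator:
  fixes A :: "('k::comm_ring_1, 'a) graded_algebra" (structure)
  assumes A: "nonassoc_algebra A"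
    and assoc: "\<And>x y z. \<lbrakk>x \<in> carrier A; y \<in> carrier A; z \<in> carrier A\<rbrakk> \<Longrightarrow> (x \<otimes> y) \<otimes> z = x \<otimes> (y \<otimes> z)"
  shows "lie_algebra (commutator_algebra A)"
proof -
  interpret nonassoc_algebra A by (rule A)
  have "nonassoc_algebra (commutator_algebra A)"
    by (rule nonassoc_algebraI)
      (simp_all add: minus_eq_smult mult_closed a_ac add_smult smult_add smult_smult
        mult_l_distr mult_r_distr mult_smult_l mult_smult_r mult.commute)
  moreover have "lie_algebra_axioms (commutator_algebra A)"
  proof (rule lie_algebra_axioms.intro, goal_cases)
    case (1 x)
    then show ?case
      by (simp add: a_minus_def r_neg mult_closed)
  next
    case (2 x y z)
    then show ?case
      by (simp add: mult_minus_l mult_minus_r mult_closed assoc cyclic_sum_zero)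
  qed
  ultimately show ?thesis
    by (rule lie_algebra.intro)
qed

lemma algebra_hom_commutator:
  assumes "nonassoc_algebra A" "nonassoc_algebra B" "algebra_hom A B h"
  shows "algebra_hom (commutator_algebra A) (commutator_algebra B) h"
proof -
  interpret A: nonassoc_algebra A by fact
  note h = algebra_homD[OF assms(3)]
  show ?thesis
    using h by (simp add: algebra_hom_def linear_on_def A.mult_closed
        linear_on_minus[OF assms(1,2) h(1)])
qed

text \<open>The properties of a 3-grading through which the values of monomials stay in the pieces of their
  degrees, so that monomials of degree outside \<open>{-1, 0, 1}\<close> are evaluated to \<open>0\<close>.\<close>

locale graded_lie_algebra = lie_algebra L
  for L :: "('k::comm_ring_1, 'l, 'm) graded_algebra_scheme" (structure) +
  assumes grade_submodule: "Module.submodule (grade L k) class_ring L"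
    and grade_trivial: "k \<notin> {-1, 0, 1} \<Longrightarrow> grade L k = {\<zero>}"
    and grade_mult: "\<lbrakk>x \<in> grade L i; y \<in> grade L j\<rbrakk> \<Longrightarrow> x \<otimes> y \<in> grade L (i + j)"

section \<open>The extension property of the free 3-graded Lie algebra\<close>

interpretation magma: multiplicative_basis "{t. set_magma t \<subseteq> Xp \<union> Xm}" Op "magma_degree Xp"
  for Xp Xm :: "'x set"
proof
  fix m :: "'x magma"
  show "finite {(u, v). Op u v = m}"
    by (cases m) (auto intro: finite_subset[of _ "{(u, v)}" for u v])
qed auto

lemmas free_nonassoc_algebra = magma.nonassoc_algebra_MA[folded free_nonassoc_def]
  and free_nonassoc_linear_eqI = magma.linear_on_eqI[folded free_nonassoc_def]
  and free_nonassoc_hom = magma.algebra_hom_linear_extension[folded free_nonassoc_def]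
  and free_nonassoc_monomial = magma.monomial_carrier[folded free_nonassoc_def]
  and free_nonassoc_monomial_mult = magma.monomial_mult[folded free_nonassoc_def]
  and free_nonassoc_extension_monomial = magma.linear_extension_monomial[folded free_nonassoc_def]
  and free_nonassoc_extension_submodule = magma.linear_extension_submodule[folded free_nonassoc_def]
  and free_nonassoc_grade = magma.MA_simps(6)[folded free_nonassoc_def]
  and free_nonassoc_carrier = magma.MA_simps(1)[folded free_nonassoc_def]

primrec eval_magma :: "('l, 'm) monoid_scheme \<Rightarrow> ('x \<Rightarrow> 'l) \<Rightarrow> 'x magma \<Rightarrow> 'l"
  where
    "eval_magma B \<phi> (Gen x) = \<phi> x"
  | "eval_magma B \<phi> (Op s t) = eval_magma B \<phi> s \<otimes>\<^bsub>B\<^esub> eval_magma B \<phi> t"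

abbreviation eval_poly ::
  "('k::comm_ring_1, 'l, 'm) module_scheme \<Rightarrow> ('x \<Rightarrow> 'l) \<Rightarrow> ('x magma \<Rightarrow> 'k) \<Rightarrow> 'l"
  where "eval_poly B \<phi> \<equiv> linear_extension B (eval_magma B \<phi>)"

lemma (in nonassoc_algebra) eval_magma_carrier:
  assumes "\<phi> ` X \<subseteq> carrier A" "set_magma t \<subseteq> X"
  shows "eval_magma A \<phi> t \<in> carrier A"
  using assms(2) by (induction t) (use assms(1) in \<open>auto simp: mult_closed\<close>)

lemma (in nonassoc_algebra) eval_poly_hom:
  assumes "\<phi> ` (Xp \<union> Xm) \<subseteq> carrier A"
  shows "algebra_hom (free_nonassoc Xp Xm) A (eval_poly A \<phi>)"
  using eval_magma_carrier[OF assms] nonassoc_algebra_axioms by (intro free_nonassoc_hom) auto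

lemma eval_poly_monomial:
  assumes "nonassoc_algebra A" "\<phi> ` (Xp \<union> Xm) \<subseteq> carrier A" "set_magma t \<subseteq> Xp \<union> Xm"
  shows "eval_poly A \<phi> (monomial t) = eval_magma A \<phi> t"
  using nonassoc_algebra.eval_magma_carrier[OF assms(1,2)] assms(1,3)
  by (intro free_nonassoc_extension_monomial) auto

text \<open>The uniqueness half of the universal property: a homomorphism is determined on monomials by its
  values on the generators, and hence everywhere by linearity.\<close>

lemma algebra_hom_eq_eval_poly:
  assumes A: "nonassoc_algebra A" and hom: "algebra_hom (free_nonassoc Xp Xm) A h"
    and gen: "\<And>x. x \<in> Xp \<union> Xm \<Longrightarrow> h (monomial (Gen x)) = \<phi> x"
    and F: "F \<in> carrier (free_nonassoc Xp Xm)"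
  shows "h F = eval_poly A \<phi> F"
proof -
  note h = algebra_homD[OF hom]
  have \<phi>: "\<phi> ` (Xp \<union> Xm) \<subseteq> carrier A"
  proof
    fix y assume "y \<in> \<phi> ` (Xp \<union> Xm)"
    then obtain x where x: "x \<in> Xp \<union> Xm" "y = \<phi> x"
      by auto
    then have "h (monomial (Gen x)) \<in> carrier A"
      by (intro h(2) free_nonassoc_monomial) simp
    then show "y \<in> carrier A"
      using x gen by simp
  qed
  have "h (monomial t) = eval_magma A \<phi> t" if "set_magma t \<subseteq> Xp \<union> Xm" for t
    using that
  proof (induction t)
    case (Op s t)
    have "h (monomial (Op s t))
        = h (monomial s \<otimes>\<^bsub>free_nonassoc Xp Xm\<^esub> monomial t)"
      by (simp add: free_nonassoc_monomial_mult)
    also have "\<dots> = h (monomial s) \<otimes>\<^bsub>A\<^esub> h (monomial t)"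
      using Op.prems by (intro h(5) free_nonassoc_monomial) auto
    finally show ?case
      using Op by simp
  qed (simp add: gen)
  then show ?thesis
    using eval_poly_monomial[OF A \<phi>]
    by (intro free_nonassoc_linear_eqI[OF A h(1)
          algebra_homD(1)[OF nonassoc_algebra.eval_poly_hom[OF A \<phi>]] _ F]) simp
qed

text \<open>Naturality of evaluation. It moves computations in the subalgebras \<open>SL\<close> and \<open>sl(p+q)\<close> to the ambient
  commutator algebras, and from there back to words.\<close>

lemma hom_eval_poly:
  assumes "nonassoc_algebra A" "nonassoc_algebra B" "algebra_hom A B h"
    and "\<phi> ` (Xp \<union> Xm) \<subseteq> carrier A" and "F \<in> carrier (free_nonassoc Xp Xm)"
    and "\<And>x. x \<in> Xp \<union> Xm \<Longrightarrow> h (\<phi> x) = \<psi> x"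
  shows "h (eval_poly A \<phi> F) = eval_poly B \<psi> F"
  using eval_poly_monomial[OF assms(1,4), of "Gen _"] assms(6)
  by (intro algebra_hom_eq_eval_poly[OF assms(2)
        algebra_hom_comp[OF nonassoc_algebra.eval_poly_hom[OF assms(1,4)] assms(3)] _ assms(5)]) simp

lemma algebra_ideal_lie_ideal:
  "algebra_ideal (free_nonassoc Xp Xm) (lie_ideal Xp Xm :: ('x magma \<Rightarrow> 'k::comm_ring_1) set)"
proof -
  interpret nonassoc_algebra "free_nonassoc Xp Xm :: ('k, _) graded_algebra"
    by (rule free_nonassoc_algebra)
  show ?thesis
    unfolding lie_ideal_def
    by (rule algebra_ideal_hull)
      (auto simp: lie_relations_def Let_def mult_closed intro!: free_nonassoc_monomial)
qed

context graded_lie_algebra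
begin

context
  fixes Xp Xm :: "'x set" and \<phi>
  assumes \<phi>: "\<phi> \<in> polarized_maps Xp Xm L"
begin

lemma grade_carrier: "grade L k \<subseteq> carrier L"
  using grade_submodule by (simp add: submodule_iff)

lemma polarized_carrier: "\<phi> ` (Xp \<union> Xm) \<subseteq> carrier L"
  using \<phi> grade_carrier[of 1] grade_carrier[of "-1"] by (auto simp: polarized_maps_def)

lemma eval_magma_grade: "set_magma t \<subseteq> Xp \<union> Xm \<Longrightarrow> eval_magma L \<phi> t \<in> grade L (magma_degree Xp t)"
  by (induction t) (use \<phi> in \<open>auto simp: polarized_maps_def sign_degree_def grade_mult\<close>)

lemma eval_poly_grade:
  assumes "F \<in> grade (free_nonassoc Xp Xm) k"
  shows "eval_poly L \<phi> F \<in> grade L k"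
proof (rule free_nonassoc_extension_submodule[of L Xp Xm])
  show "F \<in> carrier (free_nonassoc Xp Xm)"
    using assms by (auto simp: free_nonassoc_grade free_nonassoc_carrier)
  show "eval_magma L \<phi> t \<in> grade L k" if "F t \<noteq> 0" for t
    using that assms eval_magma_grade[of t] by (auto simp: free_nonassoc_grade)
qed (use eval_magma_carrier[OF polarized_carrier] grade_submodule nonassoc_algebra_axioms in auto)

text \<open>The Lie identities hold in the target, and the monomials of degree outside \<open>{-1, 0, 1}\<close> take values in
  a trivial piece of the grading.\<close>

lemma lie_ideal_kernel:
  "lie_ideal Xp Xm \<subseteq> {F \<in> carrier (free_nonassoc Xp Xm). eval_poly L \<phi> F = \<zero>}"
  unfolding lie_ideal_def
proof (rule hull_minimal)
  interpret N: nonassoc_algebra "free_nonassoc Xp Xm :: ('k, _) graded_algebra"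
    by (rule free_nonassoc_algebra)
  note hom = eval_poly_hom[OF polarized_carrier]
  show "algebra_ideal (free_nonassoc Xp Xm) {F \<in> carrier (free_nonassoc Xp Xm). eval_poly L \<phi> F = \<zero>}"
    by (rule algebra_ideal_kernel[OF free_nonassoc_algebra nonassoc_algebra_axioms hom])
  have "eval_poly L \<phi> (monomial t) = \<zero>"
    if "set_magma t \<subseteq> Xp \<union> Xm" "magma_degree Xp t \<notin> {-1, 0, 1}" for t
    using eval_magma_grade[OF that(1)] grade_trivial[OF that(2)]
      eval_poly_monomial[OF nonassoc_algebra_axioms polarized_carrier that(1)] by auto
  then show "lie_relations Xp Xm \<subseteq> {F \<in> carrier (free_nonassoc Xp Xm). eval_poly L \<phi> F = \<zero>}"
    using algebra_homD[OF hom] alternating jacobi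
    by (auto simp: lie_relations_def Let_def N.mult_closed intro!: free_nonassoc_monomial)
qed

text \<open>Evaluation factors through the free Lie algebra because it annihilates the ideal of relations; any
  other homomorphism with the same values on generators agrees with it on cosets. So the definite
  description of the extension denotes this map.\<close>

lemma extension_coset:
  assumes F: "F \<in> carrier (free_nonassoc Xp Xm)"
  shows "extension Xp Xm L \<phi> (lie_ideal Xp Xm +>\<^bsub>free_nonassoc Xp Xm\<^esub> F) = eval_poly L \<phi> F"
proof -
  let ?A = "free_nonassoc Xp Xm :: ('k, _) graded_algebra"
  let ?q = "\<lambda>F. lie_ideal Xp Xm +>\<^bsub>?A\<^esub> F"
  interpret N: nonassoc_algebra ?A
    by (rule free_nonassoc_algebra)
  note quot = quotient_add[OF free_nonassoc_algebra algebra_ideal_lie_ideal]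
    quotient_smult[OF free_nonassoc_algebra algebra_ideal_lie_ideal]
    quotient_mult[OF free_nonassoc_algebra algebra_ideal_lie_ideal]
  note hom = eval_poly_hom[OF polarized_carrier]
  have carr: "carrier (free_lie Xp Xm) = ?q ` carrier ?A"
    by (simp add: free_lie_def quotient_algebra_sel)
  have "\<exists>h \<in> extensional (carrier (quotient_algebra ?A (lie_ideal Xp Xm))).
      \<forall>F \<in> carrier ?A. h (?q F) = eval_poly L \<phi> F"
    using lie_ideal_kernel
    by (intro factor_through_quotient[OF free_nonassoc_algebra algebra_ideal_lie_ideal
          nonassoc_algebra_axioms algebra_homD(1)[OF hom]]) auto
  then obtain h where ext: "h \<in> extensional (carrier (free_lie Xp Xm))"
    and h: "\<And>F. F \<in> carrier ?A \<Longrightarrow> h (?q F) = eval_poly L \<phi> F"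
    by (auto simp: free_lie_def)
  have grade_sub: "grade ?A k \<subseteq> carrier ?A" for k
    by (auto simp: free_nonassoc_grade free_nonassoc_carrier)
  have gens: "monomial (Gen x) \<in> carrier ?A" if "x \<in> Xp \<union> Xm" for x
    using that by (intro free_nonassoc_monomial) auto
  have "h \<in> graded_hom (free_lie Xp Xm) L"
    unfolding graded_hom_def mem_Collect_eq
  proof (intro conjI)
    show "h \<in> carrier (free_lie Xp Xm) \<rightarrow>\<^sub>E carrier L"
      using ext h algebra_homD(2)[OF hom] by (auto simp: PiE_def carr)
    show "\<forall>k. h ` grade (free_lie Xp Xm) k \<subseteq> grade L k"
      using h eval_poly_grade grade_sub
      by (auto simp: free_lie_def quotient_algebra_sel subset_iff)
  qed (use h algebra_homD[OF hom] in \<open>auto simp: carr\<close>,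
      use h algebra_homD[OF hom] in \<open>auto simp: free_lie_def quot N.mult_closed\<close>)
  moreover have "\<forall>x \<in> Xp \<union> Xm. h (lie_gen Xp Xm x) = \<phi> x"
    using h gens eval_poly_monomial[OF nonassoc_algebra_axioms polarized_carrier]
    by (auto simp: lie_gen_def)
  ultimately have "extends_to_hom Xp Xm L \<phi> h"
    by (simp add: extends_to_hom_def)
  moreover have "h' = h" if "extends_to_hom Xp Xm L \<phi> h'" for h'
  proof -
    have h': "h' \<in> carrier (free_lie Xp Xm) \<rightarrow>\<^sub>E carrier L"
      "\<And>C D. \<lbrakk>C \<in> carrier (free_lie Xp Xm); D \<in> carrier (free_lie Xp Xm)\<rbrakk>
        \<Longrightarrow> h' (C \<oplus>\<^bsub>free_lie Xp Xm\<^esub> D) = h' C \<oplus> h' D"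
      "\<And>c C. C \<in> carrier (free_lie Xp Xm) \<Longrightarrow> h' (c \<odot>\<^bsub>free_lie Xp Xm\<^esub> C) = c \<odot> h' C"
      "\<And>C D. \<lbrakk>C \<in> carrier (free_lie Xp Xm); D \<in> carrier (free_lie Xp Xm)\<rbrakk>
        \<Longrightarrow> h' (C \<otimes>\<^bsub>free_lie Xp Xm\<^esub> D) = h' C \<otimes> h' D"
      and gen: "\<And>x. x \<in> Xp \<union> Xm \<Longrightarrow> h' (lie_gen Xp Xm x) = \<phi> x"
      using that by (simp_all add: extends_to_hom_def graded_hom_def)
    have "algebra_hom (free_lie Xp Xm) L h'"
      using h' by (auto simp: algebra_hom_def linear_on_def PiE_iff)
    from algebra_hom_comp[OF quotient_map_hom[OF free_nonassoc_algebra algebra_ideal_lie_ideal]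
        this[unfolded free_lie_def]]
    have "h' (?q F) = eval_poly L \<phi> F" if "F \<in> carrier ?A" for F
      using gen that
      by (intro algebra_hom_eq_eval_poly[OF nonassoc_algebra_axioms, of Xp Xm "\<lambda>F. h' (?q F)"])
        (simp_all add: lie_gen_def)
    then have "h' C = h C" if "C \<in> carrier (free_lie Xp Xm)" for C
      using that h by (auto simp: carr)
    then show "h' = h"
      using h'(1) ext by (intro extensionalityI) (auto simp: PiE_def)
  qed
  ultimately have "extension Xp Xm L \<phi> = h"
    unfolding extension_def by (intro the_equality)
  then show ?thesis
    using h F by simp
qed

end

end

section \<open>The free 3-graded associative algebra and its special Lie subalgebra\<close>

interpretation word: multiplicative_basis "lists (Xp \<union> Xm)" "(@)"
    "\<lambda>w. sum_list (map (sign_degree Xp) w)"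
  for Xp Xm :: "'x set"
proof
  fix w :: "'x list"
  have "{(u, v). u @ v = w} \<subseteq> (\<lambda>i. (take i w, drop i w)) ` {..length w}"
  proof
    fix p
    assume "p \<in> {(u, v). u @ v = w}"
    then show "p \<in> (\<lambda>i. (take i w, drop i w)) ` {..length w}"
      by (intro image_eqI[of _ _ "length (fst p)"]) auto
  qed
  then show "finite {(u, v). u @ v = w}"
    by (rule finite_subset) simp
qed auto

lemmas free_assoc_algebra = word.nonassoc_algebra_MA[folded free_assoc_def]
  and free_assoc_assoc = word.MA_assoc[folded free_assoc_def, OF append_assoc]
  and free_assoc_hom = word.algebra_hom_linear_extension[folded free_assoc_def]
  and free_assoc_monomial = word.monomial_carrier[folded free_assoc_def]
  and free_assoc_monomial_grade = word.monomial_grade[folded free_assoc_def]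
  and free_assoc_monomial_mult = word.monomial_mult[folded free_assoc_def]
  and free_assoc_extension_monomial = word.linear_extension_monomial[folded free_assoc_def]
  and free_assoc_submodule_grade = word.submodule_grade_MA[folded free_assoc_def]
  and free_assoc_submodule_spanned = word.submodule_spanned[folded free_assoc_def]
  and free_assoc_grade_mult = word.grade_mult_MA[folded free_assoc_def]
  and free_assoc_sel = word.MA_simps[folded free_assoc_def]

lemma algebra_ideal_assoc_ideal:
  "algebra_ideal (free_assoc Xp Xm) (assoc_ideal Xp Xm :: ('x list \<Rightarrow> 'k::comm_ring_1) set)"
  unfolding assoc_ideal_def
  by (rule nonassoc_algebra.algebra_ideal_hull[OF free_assoc_algebra])
    (auto intro!: free_assoc_monomial)

lemma submodule_assoc_ideal:
  "Module.submodule (assoc_ideal Xp Xm :: ('x list \<Rightarrow> 'k::comm_ring_1) set)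
    class_ring (free_assoc Xp Xm)"
  using algebra_ideal_assoc_ideal by (auto simp: algebra_ideal_def)

text \<open>Two neighbouring letters of equal sign form a factor that is a generator of the ideal.\<close>

lemma not_alternating_in_assoc_ideal:
  assumes w: "w \<in> lists (Xp \<union> Xm)" "\<not> alternating_word Xp w"
  shows "(monomial w :: _ \<Rightarrow> 'k::comm_ring_1) \<in> assoc_ideal Xp Xm"
proof -
  let ?A = "free_assoc Xp Xm :: ('k, _) graded_algebra"
  have "\<exists>u x y v. w = u @ [x, y] @ v \<and> (x \<in> Xp \<longleftrightarrow> y \<in> Xp)"
    using w(2)
  proof (induction w)
    case (Cons a w)
    show ?case
    proof (cases "alternating_word Xp w")
      case True
      then obtain b w' where "w = b # w'" "a \<in> Xp \<longleftrightarrow> b \<in> Xp"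
        using Cons.prems by (cases w) (auto simp: alternating_word_def)
      then show ?thesis
        by (intro exI[of _ "[]"]) auto
    next
      case False
      then obtain u x y v where "w = u @ [x, y] @ v" "x \<in> Xp \<longleftrightarrow> y \<in> Xp"
        using Cons.IH by blast
      then show ?thesis
        by (intro exI[of _ "a # u"]) auto
    qed
  qed (simp add: alternating_word_def)
  then obtain u x y v where uv: "w = u @ [x, y] @ v" "x \<in> Xp \<longleftrightarrow> y \<in> Xp"
    by blast
  then have carr: "monomial u \<in> carrier ?A" "monomial v \<in> carrier ?A"
    using w(1) by (auto intro!: free_assoc_monomial)
  have "(monomial [x, y] :: _ \<Rightarrow> 'k) \<in> assoc_ideal Xp Xm"
    unfolding assoc_ideal_def by (rule hull_inc) (use uv w(1) in auto)
  then have "monomial u \<otimes>\<^bsub>?A\<^esub> (monomial [x, y] \<otimes>\<^bsub>?A\<^esub> monomial v) \<in> assoc_ideal Xp Xm"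
    using carr by (intro ideal_mult[OF free_assoc_algebra algebra_ideal_assoc_ideal])
  then show ?thesis
    by (simp add: free_assoc_monomial_mult uv(1))
qed

lemma assoc_ideal_if_no_alternating:
  assumes "G \<in> carrier (free_assoc Xp Xm)" "\<And>w. alternating_word Xp w \<Longrightarrow> G w = 0"
  shows "G \<in> assoc_ideal Xp Xm"
  by (rule free_assoc_submodule_spanned[OF submodule_assoc_ideal assms(1)])
    (use assms(2) in \<open>auto intro!: not_alternating_in_assoc_ideal\<close>)

text \<open>Neighbouring signs cancel in pairs from the right, which leaves nothing or the first letter.\<close>

lemma alternating_word_degree:
  "alternating_word Xp w \<Longrightarrow> sum_list (map (sign_degree Xp) w) \<in> {-1, 0, 1}"
proof -
  assume "alternating_word Xp w"
  then have "sum_list (map (sign_degree Xp) w) = 0 \<or>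
      w \<noteq> [] \<and> sum_list (map (sign_degree Xp) w) = sign_degree Xp (hd w)"
  proof (induction w)
    case (Cons a w)
    then show ?case
      by (cases w) (auto simp: alternating_word_def sign_degree_def)
  qed simp
  then show ?thesis
    by (auto simp: sign_degree_def split: if_splits)
qed

lemma Ass_nonassoc_algebra: "nonassoc_algebra (Ass Xp Xm)"
  unfolding Ass_def by (rule quotient_nonassoc_algebra[OF free_assoc_algebra algebra_ideal_assoc_ideal])

lemma Ass_map_hom:
  "algebra_hom (free_assoc Xp Xm) (Ass Xp Xm)
    (\<lambda>G. (assoc_ideal Xp Xm :: ('x list \<Rightarrow> 'k::comm_ring_1) set) +>\<^bsub>free_assoc Xp Xm\<^esub> G)"
  unfolding Ass_def by (rule quotient_map_hom[OF free_assoc_algebra algebra_ideal_assoc_ideal])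

lemma Ass_sel:
  "carrier (Ass Xp Xm) = (\<lambda>G. assoc_ideal Xp Xm +>\<^bsub>free_assoc Xp Xm\<^esub> G) ` carrier (free_assoc Xp Xm)"
  "\<zero>\<^bsub>Ass Xp Xm\<^esub> = assoc_ideal Xp Xm"
  "grade (Ass Xp Xm) k = (\<lambda>G. assoc_ideal Xp Xm +>\<^bsub>free_assoc Xp Xm\<^esub> G) ` grade (free_assoc Xp Xm) k"
  by (simp_all add: Ass_def quotient_algebra_sel)

lemma free_assoc_commutator_lie: "lie_algebra (commutator_algebra (free_assoc Xp Xm))"
  using free_assoc_assoc by (intro lie_algebra_commutator free_assoc_algebra)

lemma Ass_commutator_lie:
  "lie_algebra (commutator_algebra (Ass Xp Xm :: ('k::comm_ring_1, ('x list \<Rightarrow> 'k) set) graded_algebra))"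
proof (rule lie_algebra_commutator[OF Ass_nonassoc_algebra])
  interpret N: nonassoc_algebra "free_assoc Xp Xm :: ('k, 'x list \<Rightarrow> 'k) graded_algebra"
    by (rule free_assoc_algebra)
  fix x y z :: "('x list \<Rightarrow> 'k) set"
  assume "x \<in> carrier (Ass Xp Xm)" "y \<in> carrier (Ass Xp Xm)" "z \<in> carrier (Ass Xp Xm)"
  then show "(x \<otimes>\<^bsub>Ass Xp Xm\<^esub> y) \<otimes>\<^bsub>Ass Xp Xm\<^esub> z = x \<otimes>\<^bsub>Ass Xp Xm\<^esub> (y \<otimes>\<^bsub>Ass Xp Xm\<^esub> z)"
    by (auto simp: Ass_sel(1) algebra_homD(5)[OF Ass_map_hom, symmetric] N.mult_closed
        free_assoc_assoc)
qed

text \<open>A word whose degree is outside \<open>{-1, 0, 1}\<close> cannot alternate and therefore vanishes in the quotient;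
  the other two properties are inherited from the degree of words.\<close>

lemma Ass_grade:
  shows "Module.submodule (grade (Ass Xp Xm :: ('k::comm_ring_1, ('x list \<Rightarrow> 'k) set) graded_algebra) k)
      class_ring (Ass Xp Xm)" (is ?sub)
    and "k \<notin> {-1, 0, 1} \<Longrightarrow> grade (Ass Xp Xm :: ('k, ('x list \<Rightarrow> 'k) set) graded_algebra) k
      = {assoc_ideal Xp Xm}"
    and "\<lbrakk>x \<in> grade (Ass Xp Xm :: ('k, ('x list \<Rightarrow> 'k) set) graded_algebra) i; y \<in> grade (Ass Xp Xm) j\<rbrakk>
      \<Longrightarrow> x \<otimes>\<^bsub>Ass Xp Xm\<^esub> y \<in> grade (Ass Xp Xm) (i + j)"
proof -
  let ?F = "free_assoc Xp Xm :: ('k, 'x list \<Rightarrow> 'k) graded_algebra"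
  let ?A = "Ass Xp Xm :: ('k, ('x list \<Rightarrow> 'k) set) graded_algebra"
  interpret F: nonassoc_algebra ?F
    by (rule free_assoc_algebra)
  interpret A: nonassoc_algebra ?A
    by (rule Ass_nonassoc_algebra)
  note q = algebra_homD[OF Ass_map_hom]
  have sub: "Module.submodule (grade ?F k) class_ring ?F" for k
    by (rule free_assoc_submodule_grade)
  have gF: "grade ?F k \<subseteq> carrier ?F" "\<zero>\<^bsub>?F\<^esub> \<in> grade ?F k"
    "\<And>x y. \<lbrakk>x \<in> grade ?F k; y \<in> grade ?F k\<rbrakk> \<Longrightarrow> x \<oplus>\<^bsub>?F\<^esub> y \<in> grade ?F k"
    "\<And>c x. x \<in> grade ?F k \<Longrightarrow> c \<odot>\<^bsub>?F\<^esub> x \<in> grade ?F k" for k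
    using sub[of k] unfolding F.submodule_iff by blast+
  have gF1: "x \<in> grade ?F k \<Longrightarrow> x \<in> carrier ?F" for x k
    using gF(1) by blast
  have zero: "\<zero>\<^bsub>?A\<^esub> = assoc_ideal Xp Xm +>\<^bsub>?F\<^esub> \<zero>\<^bsub>?F\<^esub>"
    by (rule linear_on_zero[OF free_assoc_algebra Ass_nonassoc_algebra q(1), symmetric])
  show ?sub
    unfolding A.submodule_iff
  proof (intro conjI)
    show "grade ?A k \<subseteq> carrier ?A"
      using gF(1) by (auto simp: Ass_sel)
    show "\<zero>\<^bsub>?A\<^esub> \<in> grade ?A k"
      using gF(2) by (simp add: Ass_sel(3) zero)
    show "\<forall>x \<in> grade ?A k. \<forall>y \<in> grade ?A k. x \<oplus>\<^bsub>?A\<^esub> y \<in> grade ?A k"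
      using gF(3) by (auto simp: Ass_sel(3) gF1 q(3)[symmetric])
    show "\<forall>c. \<forall>x \<in> grade ?A k. c \<odot>\<^bsub>?A\<^esub> x \<in> grade ?A k"
      using gF(4) by (auto simp: Ass_sel(3) gF1 q(4)[symmetric])
  qed
  show "x \<otimes>\<^bsub>?A\<^esub> y \<in> grade ?A (i + j)" if "x \<in> grade ?A i" "y \<in> grade ?A j"
    using that
    by (auto simp: Ass_sel(3) gF1 q(5)[symmetric] intro!: imageI free_assoc_grade_mult)
  assume k: "k \<notin> {-1, 0, 1}"
  have "assoc_ideal Xp Xm +>\<^bsub>?F\<^esub> G = assoc_ideal Xp Xm" if "G \<in> grade ?F k" for G
  proof -
    have "G w = 0" if "alternating_word Xp w" for w
      using \<open>G \<in> grade ?F k\<close> alternating_word_degree[OF that] k by (auto simp: free_assoc_sel(6))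
    then have "G \<in> assoc_ideal Xp Xm"
      using gF1[OF that] by (intro assoc_ideal_if_no_alternating)
    then show ?thesis
      using coset_eq_zero_iff[OF free_assoc_algebra algebra_ideal_assoc_ideal gF1[OF that]] by simp
  qed
  then show "grade ?A k = {assoc_ideal Xp Xm}"
    using gF(2)[of k] by (auto simp: Ass_sel(3) image_iff)
qed

lemma SL_sel:
  "carrier (SL Xp Xm) = subalgebra (commutator_algebra (Ass Xp Xm)) hull (assoc_gen Xp Xm ` (Xp \<union> Xm))"
  "\<zero>\<^bsub>SL Xp Xm\<^esub> = assoc_ideal Xp Xm" "add (SL Xp Xm) = add (Ass Xp Xm)"
  "smult (SL Xp Xm) = smult (Ass Xp Xm)"
  "x \<otimes>\<^bsub>SL Xp Xm\<^esub> y = x \<otimes>\<^bsub>commutator_algebra (Ass Xp Xm)\<^esub> y"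
  "grade (SL Xp Xm) k = grade (Ass Xp Xm) k \<inter> carrier (SL Xp Xm)"
  by (simp_all add: SL_def generated_subalgebra_def Ass_sel commutator_algebra_def)

lemma assoc_gen_carrier:
  "assoc_gen Xp Xm ` (Xp \<union> Xm) \<subseteq> carrier (Ass Xp Xm :: ('k::comm_ring_1, ('x list \<Rightarrow> 'k) set) graded_algebra)"
  by (auto simp: assoc_gen_def Ass_sel intro!: imageI free_assoc_monomial)

lemma SL_subalgebra: "subalgebra (commutator_algebra (Ass Xp Xm)) (carrier (SL Xp Xm))"
proof -
  interpret lie_algebra "commutator_algebra (Ass Xp Xm)"
    by (rule Ass_commutator_lie)
  show ?thesis
    unfolding SL_sel using assoc_gen_carrier by (intro subalgebra_hull) simp
qed

lemma SL_graded_lie_algebra: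
  "graded_lie_algebra (SL Xp Xm :: ('k::comm_ring_1, ('x list \<Rightarrow> 'k) set) graded_algebra)"
proof -
  let ?S = "SL Xp Xm :: ('k, ('x list \<Rightarrow> 'k) set) graded_algebra"
  let ?A = "Ass Xp Xm :: ('k, ('x list \<Rightarrow> 'k) set) graded_algebra"
  interpret A: nonassoc_algebra ?A
    by (rule Ass_nonassoc_algebra)
  interpret C: lie_algebra "commutator_algebra ?A"
    by (rule Ass_commutator_lie)
  have "lie_algebra ?S"
    by (rule lie_algebra_restrict[OF Ass_commutator_lie SL_subalgebra]) (simp_all add: SL_sel Ass_sel)
  then interpret S: lie_algebra ?S .
  have sub: "Module.submodule (grade ?A k) class_ring ?A" for k
    by (rule Ass_grade(1))
  have gA: "grade ?A k \<subseteq> carrier ?A" "\<zero>\<^bsub>?A\<^esub> \<in> grade ?A k"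
    "\<And>x y. \<lbrakk>x \<in> grade ?A k; y \<in> grade ?A k\<rbrakk> \<Longrightarrow> x \<oplus>\<^bsub>?A\<^esub> y \<in> grade ?A k"
    "\<And>c x. x \<in> grade ?A k \<Longrightarrow> c \<odot>\<^bsub>?A\<^esub> x \<in> grade ?A k" for k
    using sub[of k] unfolding A.submodule_iff by blast+
  show ?thesis
  proof (intro graded_lie_algebra.intro graded_lie_algebra_axioms.intro)
    show "lie_algebra ?S"
      by (rule S.lie_algebra_axioms)
    show "Module.submodule (grade ?S k) class_ring ?S" for k
      unfolding S.submodule_iff
    proof (intro conjI)
      show "\<zero>\<^bsub>?S\<^esub> \<in> grade ?S k"
        using gA(2) S.zero_closed by (simp add: SL_sel(2,6) Ass_sel(2))
      show "\<forall>x \<in> grade ?S k. \<forall>y \<in> grade ?S k. x \<oplus>\<^bsub>?S\<^esub> y \<in> grade ?S k"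
        using gA(3) S.a_closed by (auto simp: SL_sel(3,6))
      show "\<forall>c. \<forall>x \<in> grade ?S k. c \<odot>\<^bsub>?S\<^esub> x \<in> grade ?S k"
        using gA(4) S.smult_carrier by (auto simp: SL_sel(4,6))
    qed (simp add: SL_sel(6))
    show "grade ?S k = {\<zero>\<^bsub>?S\<^esub>}" if "k \<notin> {-1, 0, 1}" for k
      using Ass_grade(2)[OF that] S.zero_closed by (auto simp: SL_sel(2,6))
    show "x \<otimes>\<^bsub>?S\<^esub> y \<in> grade ?S (i + j)" if "x \<in> grade ?S i" "y \<in> grade ?S j" for x y i j
    proof -
      have "x \<otimes>\<^bsub>?A\<^esub> y \<in> grade ?A (i + j)" "y \<otimes>\<^bsub>?A\<^esub> x \<in> grade ?A (i + j)"
        using that Ass_grade(3)[of x Xp Xm i y j] Ass_grade(3)[of y Xp Xm j x i]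
        by (auto simp: SL_sel(6) add.commute)
      then have "x \<otimes>\<^bsub>?S\<^esub> y \<in> grade ?A (i + j)"
        using A.submodule_minus[OF sub] by (simp add: SL_sel(5))
      then show ?thesis
        using that S.mult_closed by (simp add: SL_sel(6))
    qed
  qed
qed

lemma assoc_gen_polarized:
  assumes "Xp \<inter> Xm = {}"
  shows "assoc_gen Xp Xm \<in> polarized_maps Xp Xm
    (SL Xp Xm :: ('k::comm_ring_1, ('x list \<Rightarrow> 'k) set) graded_algebra)"
proof -
  have "(assoc_gen Xp Xm x :: ('x list \<Rightarrow> 'k) set) \<in> grade (SL Xp Xm) (sign_degree Xp x)"
    if "x \<in> Xp \<union> Xm" for x
  proof -
    have "monomial [x] \<in> grade (free_assoc Xp Xm) (sign_degree Xp x)"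
      using that free_assoc_monomial_grade[of "[x]" Xp Xm] by simp
    then show ?thesis
      using that by (auto simp: SL_sel(6) Ass_sel(3) assoc_gen_def)
        (auto simp: SL_sel(1) assoc_gen_def intro!: hull_inc)
  qed
  note gen = this
  have "x \<in> Xp \<Longrightarrow> (assoc_gen Xp Xm x :: ('x list \<Rightarrow> 'k) set) \<in> grade (SL Xp Xm) 1"
    "x \<in> Xm \<Longrightarrow> (assoc_gen Xp Xm x :: ('x list \<Rightarrow> 'k) set) \<in> grade (SL Xp Xm) (-1)" for x
    using gen[of x] assms by (auto simp: sign_degree_def split: if_splits)
  then show ?thesis
    by (auto simp: polarized_maps_def)
qed

text \<open>Evaluation at the letters with products read as commutators of words: the lift of \<open>\<pi>\<close> to
  representatives on both sides.\<close>

abbreviation commutator_poly :: "'x set \<Rightarrow> 'x set \<Rightarrow> ('x magma \<Rightarrow> 'k::comm_ring_1) \<Rightarrow> 'x list \<Rightarrow> 'k"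
  where "commutator_poly Xp Xm \<equiv>
    eval_poly (commutator_algebra (free_assoc Xp Xm)) (\<lambda>x. monomial [x])"

lemma commutator_poly_carrier:
  assumes "(F :: 'x magma \<Rightarrow> 'k::comm_ring_1) \<in> carrier (free_nonassoc Xp Xm)"
  shows "commutator_poly Xp Xm F \<in> carrier (free_assoc Xp Xm)"
proof -
  interpret lie_algebra "commutator_algebra (free_assoc Xp Xm :: ('k, 'x list \<Rightarrow> 'k) graded_algebra)"
    by (rule free_assoc_commutator_lie)
  have "(\<lambda>x. monomial [x]) ` (Xp \<union> Xm)
      \<subseteq> carrier (commutator_algebra (free_assoc Xp Xm :: ('k, 'x list \<Rightarrow> 'k) graded_algebra))"
    by (auto intro!: free_assoc_monomial)
  from algebra_homD(2)[OF eval_poly_hom[OF this] assms] show ?thesis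
    by simp
qed

lemma special_proj_coset:
  assumes disjoint: "Xp \<inter> Xm = {}"
    and F: "(F :: 'x magma \<Rightarrow> 'k::comm_ring_1) \<in> carrier (free_nonassoc Xp Xm)"
  shows "special_proj Xp Xm (lie_ideal Xp Xm +>\<^bsub>free_nonassoc Xp Xm\<^esub> F)
    = assoc_ideal Xp Xm +>\<^bsub>free_assoc Xp Xm\<^esub> commutator_poly Xp Xm F"
proof -
  let ?A = "Ass Xp Xm :: ('k, ('x list \<Rightarrow> 'k) set) graded_algebra"
  let ?S = "SL Xp Xm :: ('k, ('x list \<Rightarrow> 'k) set) graded_algebra"
  interpret S: graded_lie_algebra ?S
    by (rule SL_graded_lie_algebra)
  interpret C: lie_algebra "commutator_algebra ?A"
    by (rule Ass_commutator_lie)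
  interpret W: lie_algebra "commutator_algebra (free_assoc Xp Xm :: ('k, _) graded_algebra)"
    by (rule free_assoc_commutator_lie)
  have sub: "subalgebra (commutator_algebra ?A) (carrier ?S)"
    by (rule SL_subalgebra)
  have incl: "algebra_hom ?S (commutator_algebra ?A) (\<lambda>x. x)"
    using sub
    by (auto simp: algebra_hom_def linear_on_def SL_sel(3-5) subalgebra_def C.submodule_iff)
  have "special_proj Xp Xm (lie_ideal Xp Xm +>\<^bsub>free_nonassoc Xp Xm\<^esub> F)
      = eval_poly ?S (assoc_gen Xp Xm) F"
    unfolding special_proj_def
    by (rule S.extension_coset[OF assoc_gen_polarized[OF disjoint] F])
  also have "\<dots> = eval_poly (commutator_algebra ?A) (assoc_gen Xp Xm) F"
    using hom_eval_poly[OF S.nonassoc_algebra_axioms C.nonassoc_algebra_axioms incl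
        S.polarized_carrier[OF assoc_gen_polarized[OF disjoint]] F refl] .
  also have "\<dots> = assoc_ideal Xp Xm +>\<^bsub>free_assoc Xp Xm\<^esub> commutator_poly Xp Xm F"
    by (rule hom_eval_poly[OF W.nonassoc_algebra_axioms C.nonassoc_algebra_axioms
        algebra_hom_commutator[OF free_assoc_algebra Ass_nonassoc_algebra Ass_map_hom] _ F, symmetric])
      (auto simp: assoc_gen_def intro!: free_assoc_monomial)
  finally show ?thesis .
qed

section \<open>Evaluation in traceless block matrices\<close>

definition matrix_algebra :: "nat \<Rightarrow> ('k::comm_ring_1, 'k mat) graded_algebra"
  where "matrix_algebra n =
    \<lparr>carrier = carrier_mat n n, mult = (*), one = 1\<^sub>m n, zero = 0\<^sub>m n n, add = (+),
     smult = (\<cdot>\<^sub>m), grade = (\<lambda>_. carrier_mat n n)\<rparr>"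

lemma matrix_algebra_sel [simp]:
  "carrier (matrix_algebra n) = carrier_mat n n" "add (matrix_algebra n) = (+)"
  "mult (matrix_algebra n) = (*)" "\<zero>\<^bsub>matrix_algebra n\<^esub> = 0\<^sub>m n n"
  "smult (matrix_algebra n) = (\<cdot>\<^sub>m)"
  by (simp_all add: matrix_algebra_def)

lemma matrix_nonassoc_algebra: "nonassoc_algebra (matrix_algebra n :: ('k::comm_ring_1, 'k mat) graded_algebra)"
proof (rule nonassoc_algebraI, goal_cases)
  case (5 x y z)
  then show ?case by (simp add: assoc_add_mat)
next
  case (6 x y)
  then show ?case by (simp add: comm_add_mat)
next
  case (13 x y z)
  then show ?case by (simp add: add_mult_distrib_mat)
next
  case (14 x y z)
  then show ?case by (simp add: mult_add_distrib_mat)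
next
  case (15 c x y)
  then show ?case by (simp add: mult_smult_assoc_mat)
next
  case (16 c x y)
  then show ?case by (simp add: mult_smult_distrib)
qed (auto intro!: eq_matI simp: algebra_simps)

lemma matrix_commutator_lie: "lie_algebra (commutator_algebra (matrix_algebra n))"
  by (rule lie_algebra_commutator[OF matrix_nonassoc_algebra]) (simp add: assoc_mult_mat)

lemma matrix_commutator:
  fixes A B :: "'k::comm_ring_1 mat"
  assumes "A \<in> carrier_mat n n" "B \<in> carrier_mat n n"
  shows "A \<otimes>\<^bsub>commutator_algebra (matrix_algebra n)\<^esub> B = A * B - B * A"
proof -
  interpret nonassoc_algebra "matrix_algebra n :: ('k, 'k mat) graded_algebra"
    by (rule matrix_nonassoc_algebra)
  have "B * A \<in> carrier_mat n n"
    using assms by simp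
  then have "A * B \<ominus>\<^bsub>matrix_algebra n\<^esub> B * A = A * B + (-1) \<cdot>\<^sub>m (B * A)"
    using minus_eq_smult[of "B * A" "A * B"] by simp
  also have "\<dots> = A * B - B * A"
    using assms by (intro eq_matI) auto
  finally show ?thesis
    by simp
qed

lemma trace_mult_comm:
  fixes A B :: "'k::comm_ring_1 mat"
  assumes "A \<in> carrier_mat n n" "B \<in> carrier_mat n n"
  shows "trace (A * B) = trace (B * A)"
proof -
  have "trace (A * B) = (\<Sum>i<n. \<Sum>j<n. A $$ (i, j) * B $$ (j, i))"
    using assms by (auto simp: trace_def scalar_prod_def atLeast0LessThan intro!: sum.cong)
  also have "\<dots> = (\<Sum>j<n. \<Sum>i<n. B $$ (j, i) * A $$ (i, j))"
    by (subst sum.swap) (simp add: mult.commute)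
  also have "\<dots> = trace (B * A)"
    using assms by (auto simp: trace_def scalar_prod_def atLeast0LessThan intro!: sum.cong)
  finally show ?thesis .
qed

lemma sl_sel:
  "carrier (sl p q) = {A \<in> carrier_mat (p + q) (p + q). trace A = 0}"
  "add (sl p q) = (+)" "A \<otimes>\<^bsub>sl p q\<^esub> B = A * B - B * A" "\<zero>\<^bsub>sl p q\<^esub> = 0\<^sub>m (p + q) (p + q)"
  "smult (sl p q) = (\<cdot>\<^sub>m)"
  by (simp_all add: sl_def)

lemma sl_subalgebra:
  "subalgebra (commutator_algebra (matrix_algebra (p + q)))
    (carrier (sl p q :: ('k::comm_ring_1, 'k mat) graded_algebra))"
proof -
  interpret lie_algebra "commutator_algebra (matrix_algebra (p + q)) :: ('k, 'k mat) graded_algebra"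
    by (rule matrix_commutator_lie)
  have add: "trace (A + B) = trace A + trace B" "trace (A - B) = trace A - trace B"
    "trace (c \<cdot>\<^sub>m A) = c * trace A"
    if "A \<in> carrier_mat (p + q) (p + q)" "B \<in> carrier_mat (p + q) (p + q)" for A B :: "'k mat" and c
    using that by (auto simp: trace_def sum.distrib sum_subtractf sum_distrib_left)
  have zero: "trace (0\<^sub>m (p + q) (p + q)) = (0 :: 'k)"
    by (simp add: trace_def)
  have comm: "trace (A * B - B * A) = 0"
    if "A \<in> carrier_mat (p + q) (p + q)" "B \<in> carrier_mat (p + q) (p + q)" for A B :: "'k mat"
    using that trace_mult_comm[OF that] by (simp add: add)
  show ?thesis
    unfolding subalgebra_def submodule_iff
    by (auto simp: sl_sel add zero matrix_commutator comm simp del: commutator_algebra_sel(5))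
qed

lemma all_less_add_iff: "(\<forall>i < p + q. P i) \<longleftrightarrow> (\<forall>i < p. P i) \<and> (\<forall>i < q. P (p + i))"
  for p q :: nat
proof -
  have "P i" if "\<forall>i < p. P i" "\<forall>i < q. P (p + i)" "i < p + q" for i
    using that by (cases "i < p") (auto dest: spec[of _ "i - p"])
  then show ?thesis
    by auto
qed

lemma trace_zero: "trace (0\<^sub>m n n) = 0"
  by (simp add: trace_def)

lemma trace_four_block:
  assumes "A \<in> carrier_mat p p" "B \<in> carrier_mat p q" "C \<in> carrier_mat q p" "D \<in> carrier_mat q q"
  shows "trace (four_block_mat A B C D) = trace A + trace D"
proof -
  have split: "(\<Sum>i < p + q. f i) = (\<Sum>i < p. f i) + (\<Sum>i < q. f (p + i))" for f :: "nat \<Rightarrow> 'a"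
    by (induction q) (simp_all add: add.assoc)
  show ?thesis
    using assms by (simp add: trace_def split)
qed

lemma exists_four_block:
  assumes "M \<in> carrier_mat (p + q) (p + q)"
  obtains A B C D where "A \<in> carrier_mat p p" "B \<in> carrier_mat p q" "C \<in> carrier_mat q p"
    "D \<in> carrier_mat q q" "M = four_block_mat A B C D"
proof -
  obtain A B C D where split: "split_block M p p = (A, B, C, D)"
    by (cases "split_block M p p")
  show ?thesis
    using split_block[OF split, of q q] assms by (intro that[of A B C D]) auto
qed

lemma mat_zero_iff: "X \<in> carrier_mat m n \<Longrightarrow> X = 0\<^sub>m m n \<longleftrightarrow> (\<forall>i < m. \<forall>j < n. X $$ (i, j) = 0)"
  by (auto intro!: eq_matI)

text \<open>The matrix unit at \<open>(i, j)\<close> has degree \<open>[i < p] - [j < p]\<close>. This description treats all degrees at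
  once, and degrees add up when matrices are multiplied. The trace condition is automatic in degrees
  \<open>1\<close> and \<open>-1\<close>, where the diagonal is zero.\<close>

lemma sl_grade:
  "grade (sl p q :: ('k::comm_ring_1, 'k mat) graded_algebra) k =
    {A \<in> carrier (sl p q). \<forall>i < p + q. \<forall>j < p + q.
      A $$ (i, j) \<noteq> 0 \<longrightarrow> of_bool (i < p) - of_bool (j < p) = k}" (is "_ = ?G")
proof -
  \<comment> \<open>Membership in the piece of degree \<open>k\<close> in terms of blocks, uniformly in \<open>k\<close>.\<close>
  define R where "R A B C D \<longleftrightarrow> trace A + trace D = 0 \<and>
      (k \<noteq> 1 \<longrightarrow> B = 0\<^sub>m p q) \<and> (k \<noteq> -1 \<longrightarrow> C = 0\<^sub>m q p) \<and>
      (k \<noteq> 0 \<longrightarrow> A = 0\<^sub>m p p \<and> D = 0\<^sub>m q q)" for A B C D :: "'k mat"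
  consider "k = 1" | "k = -1" | "k = 0" | "k \<noteq> 1" "k \<noteq> -1" "k \<noteq> 0"
    by blast
  note k_cases = this
  have block_iff: "four_block_mat A B C D \<in> ?G \<longleftrightarrow> R A B C D"
    if carr: "A \<in> carrier_mat p p" "B \<in> carrier_mat p q" "C \<in> carrier_mat q p" "D \<in> carrier_mat q q"
    for A B C D
  proof -
    have "four_block_mat A B C D \<in> ?G \<longleftrightarrow> trace A + trace D = 0 \<and>
        (\<forall>i < p. (\<forall>j < p. A $$ (i, j) \<noteq> 0 \<longrightarrow> 0 = k) \<and> (\<forall>j < q. B $$ (i, j) \<noteq> 0 \<longrightarrow> 1 = k)) \<and>
        (\<forall>i < q. (\<forall>j < p. C $$ (i, j) \<noteq> 0 \<longrightarrow> -1 = k) \<and> (\<forall>j < q. D $$ (i, j) \<noteq> 0 \<longrightarrow> 0 = k))"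
      using carr by (simp add: sl_sel trace_four_block[OF carr] all_less_add_iff)
    also have "\<dots> \<longleftrightarrow> R A B C D"
      by (cases rule: k_cases) (auto simp: R_def mat_zero_iff[OF carr(1)] mat_zero_iff[OF carr(2)]
          mat_zero_iff[OF carr(3)] mat_zero_iff[OF carr(4)])
    finally show ?thesis .
  qed
  show ?thesis
  proof (intro equalityI subsetI)
    fix M :: "'k mat" assume M: "M \<in> grade (sl p q) k"
    have "\<exists>A B C D. A \<in> carrier_mat p p \<and> B \<in> carrier_mat p q \<and> C \<in> carrier_mat q p \<and>
        D \<in> carrier_mat q q \<and> R A B C D \<and> M = four_block_mat A B C D"
    proof (cases rule: k_cases)
      case 1
      then obtain B where "B \<in> carrier_mat p q" "M = four_block_mat (0\<^sub>m p p) B (0\<^sub>m q p) (0\<^sub>m q q)"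
        using M by (auto simp: sl_def)
      then show ?thesis
        by (intro exI[of _ "0\<^sub>m p p"] exI[of _ B] exI[of _ "0\<^sub>m q p"] exI[of _ "0\<^sub>m q q"])
          (simp add: R_def trace_zero 1)
    next
      case 2
      then obtain C where "C \<in> carrier_mat q p" "M = four_block_mat (0\<^sub>m p p) (0\<^sub>m p q) C (0\<^sub>m q q)"
        using M by (auto simp: sl_def)
      then show ?thesis
        by (intro exI[of _ "0\<^sub>m p p"] exI[of _ "0\<^sub>m p q"] exI[of _ C] exI[of _ "0\<^sub>m q q"])
          (simp add: R_def trace_zero 2)
    next
      case 3
      then obtain A D where "A \<in> carrier_mat p p" "D \<in> carrier_mat q q" "trace A + trace D = 0"
        "M = four_block_mat A (0\<^sub>m p q) (0\<^sub>m q p) D"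
        using M by (auto simp: sl_def)
      then show ?thesis
        by (intro exI[of _ A] exI[of _ "0\<^sub>m p q"] exI[of _ "0\<^sub>m q p"] exI[of _ D])
          (simp add: R_def 3)
    next
      case 4
      then show ?thesis
        using M
        by (intro exI[of _ "0\<^sub>m p p"] exI[of _ "0\<^sub>m p q"] exI[of _ "0\<^sub>m q p"] exI[of _ "0\<^sub>m q q"])
          (simp add: R_def trace_zero sl_def)
    qed
    then obtain A B C D where ABCD: "A \<in> carrier_mat p p" "B \<in> carrier_mat p q" "C \<in> carrier_mat q p"
      "D \<in> carrier_mat q q" and MR: "R A B C D" "M = four_block_mat A B C D"
      by blast
    show "M \<in> ?G"
      using MR(1) unfolding MR(2) block_iff[OF ABCD] .
  next
    fix M assume M: "M \<in> ?G"
    then have "M \<in> carrier_mat (p + q) (p + q)"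
      by (simp add: sl_sel)
    then obtain A B C D where ABCD: "A \<in> carrier_mat p p" "B \<in> carrier_mat p q" "C \<in> carrier_mat q p"
      "D \<in> carrier_mat q q" "M = four_block_mat A B C D"
      by (rule exists_four_block)
    have "R A B C D"
      using M unfolding ABCD(5) block_iff[OF ABCD(1-4)] .
    then show "M \<in> grade (sl p q) k"
      using ABCD(1-4) unfolding ABCD(5) by (cases rule: k_cases) (auto simp: sl_def R_def)
  qed
qed

lemma sl_gradeD:
  assumes "A \<in> grade (sl p q) k"
  shows "A \<in> carrier_mat (p + q) (p + q)" "trace A = 0"
    and "\<lbrakk>i < p + q; j < p + q; of_bool (i < p) - of_bool (j < p) \<noteq> k\<rbrakk> \<Longrightarrow> A $$ (i, j) = 0"
  using assms by (auto simp: sl_grade sl_sel)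

lemma sl_gradeI:
  assumes "A \<in> carrier (sl p q)"
    and "\<And>i j. \<lbrakk>i < p + q; j < p + q; of_bool (i < p) - of_bool (j < p) \<noteq> k\<rbrakk> \<Longrightarrow> A $$ (i, j) = 0"
  shows "A \<in> grade (sl p q) k"
  unfolding sl_grade using assms by blast

lemma sl_grade_prod_entry:
  fixes A B :: "'k::comm_ring_1 mat"
  assumes A: "A \<in> grade (sl p q) k" and B: "B \<in> grade (sl p q) l"
    and ij: "i < p + q" "j < p + q" "of_bool (i < p) - of_bool (j < p) \<noteq> k + l"
  shows "(A * B) $$ (i, j) = 0"
proof -
  have carr: "A \<in> carrier_mat (p + q) (p + q)" "B \<in> carrier_mat (p + q) (p + q)"
    using sl_gradeD(1) A B by auto
  then have "(A * B) $$ (i, j) = (\<Sum>m < p + q. A $$ (i, m) * B $$ (m, j))"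
    using ij by (auto simp: scalar_prod_def atLeast0LessThan intro!: sum.cong)
  also have "\<dots> = 0"
  proof (rule sum.neutral, rule ballI)
    fix m assume m: "m \<in> {..<p + q}"
    consider "of_bool (i < p) - of_bool (m < p) \<noteq> k" | "of_bool (m < p) - of_bool (j < p) \<noteq> l"
      using ij(3) by fastforce
    then show "A $$ (i, m) * B $$ (m, j) = 0"
      using sl_gradeD(3)[OF A, of i m] sl_gradeD(3)[OF B, of m j] m ij(1,2) by cases simp_all
  qed
  finally show ?thesis .
qed

lemma sl_graded_lie_algebra: "graded_lie_algebra (sl p q :: ('k::comm_ring_1, 'k mat) graded_algebra)"
proof -
  let ?S = "sl p q :: ('k, 'k mat) graded_algebra"
  have "lie_algebra ?S"
    by (rule lie_algebra_restrict[OF matrix_commutator_lie sl_subalgebra])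
      (simp_all add: sl_sel matrix_commutator del: commutator_algebra_sel(5))
  then interpret S: lie_algebra ?S .
  show ?thesis
  proof (intro graded_lie_algebra.intro graded_lie_algebra_axioms.intro)
    show "lie_algebra ?S"
      by (rule S.lie_algebra_axioms)
    show "Module.submodule (grade ?S k) class_ring ?S" for k
      unfolding S.submodule_iff
    proof (intro conjI)
      show "grade ?S k \<subseteq> carrier ?S"
        by (auto simp: sl_grade)
      show "\<zero>\<^bsub>?S\<^esub> \<in> grade ?S k"
        using S.zero_closed by (rule sl_gradeI) (simp add: sl_sel)
      show "\<forall>x \<in> grade ?S k. \<forall>y \<in> grade ?S k. x \<oplus>\<^bsub>?S\<^esub> y \<in> grade ?S k"
      proof (intro ballI)
        fix x y assume xy: "x \<in> grade ?S k" "y \<in> grade ?S k"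
        then have "x \<oplus>\<^bsub>?S\<^esub> y \<in> carrier ?S"
          by (intro S.a_closed) (simp_all add: sl_grade)
        moreover have "(x + y) $$ (i, j) = 0"
          if "i < p + q" "j < p + q" "of_bool (i < p) - of_bool (j < p) \<noteq> k" for i j
          using that xy[THEN sl_gradeD(3), OF that] xy[THEN sl_gradeD(1)] by simp
        ultimately show "x \<oplus>\<^bsub>?S\<^esub> y \<in> grade ?S k"
          by (intro sl_gradeI) (simp_all only: sl_sel(2))
      qed
      show "\<forall>c. \<forall>x \<in> grade ?S k. c \<odot>\<^bsub>?S\<^esub> x \<in> grade ?S k"
      proof (intro allI ballI)
        fix c x assume x: "x \<in> grade ?S k"
        then have "c \<odot>\<^bsub>?S\<^esub> x \<in> carrier ?S"
          by (intro S.smult_carrier) (simp_all add: sl_grade)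
        moreover have "(c \<cdot>\<^sub>m x) $$ (i, j) = 0"
          if "i < p + q" "j < p + q" "of_bool (i < p) - of_bool (j < p) \<noteq> k" for i j
          using that sl_gradeD(3)[OF x that] sl_gradeD(1)[OF x] by simp
        ultimately show "c \<odot>\<^bsub>?S\<^esub> x \<in> grade ?S k"
          by (intro sl_gradeI) (simp_all only: sl_sel(5))
      qed
    qed
    show "grade ?S k = {\<zero>\<^bsub>?S\<^esub>}" if "k \<notin> {-1, 0, 1}" for k
      using that by (simp add: sl_def)
    show "x \<otimes>\<^bsub>?S\<^esub> y \<in> grade ?S (k + l)" if xy: "x \<in> grade ?S k" "y \<in> grade ?S l" for x y k l
    proof -
      have "x \<otimes>\<^bsub>?S\<^esub> y \<in> carrier ?S"
        using xy by (intro S.mult_closed) (simp_all add: sl_grade)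
      moreover have "(x * y - y * x) $$ (i, j) = 0"
        if "i < p + q" "j < p + q" "of_bool (i < p) - of_bool (j < p) \<noteq> k + l" for i j
        using that sl_grade_prod_entry[OF xy that] sl_grade_prod_entry[OF xy(2,1), of i j]
          sl_gradeD(1)[OF xy(1)] sl_gradeD(1)[OF xy(2)] by (simp add: add.commute)
      ultimately show ?thesis
        by (intro sl_gradeI) (simp_all only: sl_sel(3))
    qed
  qed
qed

primrec eval_word :: "nat \<Rightarrow> ('x \<Rightarrow> 'k::comm_ring_1 mat) \<Rightarrow> 'x list \<Rightarrow> 'k mat"
  where
    "eval_word n \<phi> [] = 1\<^sub>m n"
  | "eval_word n \<phi> (x # w) = \<phi> x * eval_word n \<phi> w"

abbreviation eval_assoc :: "nat \<Rightarrow> ('x \<Rightarrow> 'k::comm_ring_1 mat) \<Rightarrow> ('x list \<Rightarrow> 'k) \<Rightarrow> 'k mat"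
  where "eval_assoc n \<phi> \<equiv> linear_extension (matrix_algebra n) (eval_word n \<phi>)"

lemma eval_word_carrier:
  "\<lbrakk>\<phi> ` X \<subseteq> carrier_mat n n; w \<in> lists X\<rbrakk> \<Longrightarrow> eval_word n \<phi> w \<in> carrier_mat n n"
  by (induction w) auto

lemma eval_word_append:
  assumes "\<phi> ` X \<subseteq> carrier_mat n n" "u \<in> lists X" "v \<in> lists X"
  shows "eval_word n \<phi> (u @ v) = eval_word n \<phi> u * eval_word n \<phi> v"
  using assms(2)
proof (induction u)
  case Nil
  then show ?case
    using eval_word_carrier[OF assms(1,3)] by simp
next
  case (Cons x u)
  then have "\<phi> x \<in> carrier_mat n n" "eval_word n \<phi> u \<in> carrier_mat n n"
    using assms(1) eval_word_carrier[OF assms(1), of u] by auto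
  then show ?case
    using Cons eval_word_carrier[OF assms(1,3)] by (simp add: assoc_mult_mat)
qed

context
  fixes Xp Xm :: "'x set" and n and \<phi> :: "'x \<Rightarrow> 'k::comm_ring_1 mat"
  assumes \<phi>: "\<phi> ` (Xp \<union> Xm) \<subseteq> carrier_mat n n"
begin

lemma eval_assoc_hom: "algebra_hom (free_assoc Xp Xm) (matrix_algebra n) (eval_assoc n \<phi>)"
  using eval_word_carrier[OF \<phi>] eval_word_append[OF \<phi>]
  by (intro free_assoc_hom matrix_nonassoc_algebra) auto

lemma eval_assoc_monomial:
  "w \<in> lists (Xp \<union> Xm) \<Longrightarrow> eval_assoc n \<phi> (monomial w) = eval_word n \<phi> w"
  using eval_word_carrier[OF \<phi>]
  by (intro free_assoc_extension_monomial matrix_nonassoc_algebra) auto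

text \<open>A matrix entry depends linearly on the polynomial, so it picks out the coefficient of \<open>w\<close> as soon as
  it does so for single words.\<close>

lemma eval_assoc_entry_eqI:
  assumes ij: "i < n" "j < n" and G: "G \<in> carrier (free_assoc Xp Xm)"
    and entry: "\<And>v. v \<in> lists (Xp \<union> Xm) \<Longrightarrow> eval_word n \<phi> v $$ (i, j) = (if v = w then 1 else 0)"
  shows "eval_assoc n \<phi> G $$ (i, j) = G w"
proof -
  let ?F = "free_assoc Xp Xm :: ('k, 'x list \<Rightarrow> 'k) graded_algebra"
  interpret F: nonassoc_algebra ?F
    by (rule free_assoc_algebra)
  note h = algebra_homD[OF eval_assoc_hom]
  have carr: "eval_assoc n \<phi> H \<in> carrier_mat n n" if "H \<in> carrier ?F" for H
    using h(2)[OF that] by simp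
  have dim: "dim_row (eval_assoc n \<phi> H) = n" "dim_col (eval_assoc n \<phi> H) = n" if "H \<in> carrier ?F" for H
    using carr[OF that] by auto
  have "Module.submodule {H \<in> carrier ?F. eval_assoc n \<phi> H $$ (i, j) = H w} class_ring ?F"
    unfolding F.submodule_iff
  proof (intro conjI)
    show "\<zero>\<^bsub>?F\<^esub> \<in> {H \<in> carrier ?F. eval_assoc n \<phi> H $$ (i, j) = H w}"
      using linear_on_zero[OF free_assoc_algebra matrix_nonassoc_algebra h(1)] ij
      by (simp add: free_assoc_sel(2) F.zero_closed[unfolded free_assoc_sel(2)])
  qed (use h(3,4) dim ij in \<open>auto simp: free_assoc_sel(3,4)[symmetric],
    auto simp: free_assoc_sel(3,4)\<close>)
  moreover have "monomial v \<in> {H \<in> carrier ?F. eval_assoc n \<phi> H $$ (i, j) = H w}"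
    if "v \<in> lists (Xp \<union> Xm)" for v
    using entry[OF that] free_assoc_monomial[OF that]
    by (simp only: eval_assoc_monomial[OF that] mem_Collect_eq) (simp add: monomial_def eq_commute)
  ultimately show ?thesis
    using free_assoc_submodule_spanned[OF _ G] by blast
qed

end

text \<open>The product of two matrices of degree \<open>1\<close>, or of two of degree \<open>-1\<close>, would have degree \<open>2\<close> or \<open>-2\<close>,
  which no entry has; so the generators of the ideal are evaluated to \<open>0\<close>.\<close>

lemma assoc_ideal_kernel:
  fixes \<phi> :: "'x \<Rightarrow> 'k::comm_ring_1 mat"
  assumes \<phi>: "\<phi> \<in> polarized_maps Xp Xm (sl p q)" and G: "G \<in> assoc_ideal Xp Xm"
  shows "eval_assoc (p + q) \<phi> G = 0\<^sub>m (p + q) (p + q)"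
proof -
  have carr: "\<phi> ` (Xp \<union> Xm) \<subseteq> carrier_mat (p + q) (p + q)"
    using graded_lie_algebra.polarized_carrier[OF sl_graded_lie_algebra \<phi>] by (auto simp: sl_sel)
  have zero: "eval_assoc (p + q) \<phi> (monomial [x, y]) = 0\<^sub>m (p + q) (p + q)"
    if xy: "\<phi> x \<in> grade (sl p q) k" "\<phi> y \<in> grade (sl p q) k" "k = 1 \<or> k = -1"
      "x \<in> Xp \<union> Xm" "y \<in> Xp \<union> Xm" for x y k
  proof -
    have "\<phi> x * \<phi> y = 0\<^sub>m (p + q) (p + q)"
    proof (rule eq_matI)
      fix i j assume "i < dim_row (0\<^sub>m (p + q) (p + q))" "j < dim_col (0\<^sub>m (p + q) (p + q))"
      moreover have "of_bool (i < p) - of_bool (j < p) \<noteq> k + k"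
        using xy(3) by auto
      ultimately show "(\<phi> x * \<phi> y) $$ (i, j) = 0\<^sub>m (p + q) (p + q) $$ (i, j)"
        using sl_grade_prod_entry[OF xy(1,2)] by simp
    qed (use xy(1,2)[THEN sl_gradeD(1)] in auto)
    then show ?thesis
      using xy(4,5) sl_gradeD(1)[OF xy(2)] by (simp add: eval_assoc_monomial[OF carr])
  qed
  have "assoc_ideal Xp Xm \<subseteq> {G \<in> carrier (free_assoc Xp Xm).
      eval_assoc (p + q) \<phi> G = \<zero>\<^bsub>matrix_algebra (p + q)\<^esub>}"
    unfolding assoc_ideal_def
  proof (rule hull_minimal)
    show "algebra_ideal (free_assoc Xp Xm) {G \<in> carrier (free_assoc Xp Xm).
        eval_assoc (p + q) \<phi> G = \<zero>\<^bsub>matrix_algebra (p + q)\<^esub>}"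
      by (rule algebra_ideal_kernel[OF free_assoc_algebra matrix_nonassoc_algebra eval_assoc_hom[OF carr]])
  qed (use zero[of _ 1] zero[of _ "-1"] \<phi> in
      \<open>auto simp: polarized_maps_def image_subset_iff intro!: free_assoc_monomial\<close>)
  then show ?thesis
    using G by auto
qed

text \<open>In the ambient algebra of all matrices the evaluation of words is an associative homomorphism, hence
  also one for commutators; it agrees with the evaluation of Lie monomials on letters.\<close>

lemma extension_sl_coset:
  fixes \<phi> :: "'x \<Rightarrow> 'k::comm_ring_1 mat"
  assumes \<phi>: "\<phi> \<in> polarized_maps Xp Xm (sl p q)" and F: "F \<in> carrier (free_nonassoc Xp Xm)"
  shows "extension Xp Xm (sl p q) \<phi> (lie_ideal Xp Xm +>\<^bsub>free_nonassoc Xp Xm\<^esub> F)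
    = eval_assoc (p + q) \<phi> (commutator_poly Xp Xm F)"
proof -
  let ?C = "commutator_algebra (matrix_algebra (p + q)) :: ('k, 'k mat) graded_algebra"
  interpret S: graded_lie_algebra "sl p q :: ('k, 'k mat) graded_algebra"
    by (rule sl_graded_lie_algebra)
  interpret C: lie_algebra ?C
    by (rule matrix_commutator_lie)
  interpret W: lie_algebra "commutator_algebra (free_assoc Xp Xm :: ('k, 'x list \<Rightarrow> 'k) graded_algebra)"
    by (rule free_assoc_commutator_lie)
  have carr: "\<phi> ` (Xp \<union> Xm) \<subseteq> carrier_mat (p + q) (p + q)"
    using S.polarized_carrier[OF \<phi>] by (auto simp: sl_sel)
  have incl: "algebra_hom (sl p q) ?C (\<lambda>x. x)"
    by (simp add: algebra_hom_def linear_on_def sl_sel matrix_commutator del: commutator_algebra_sel(5))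
  have "extension Xp Xm (sl p q) \<phi> (lie_ideal Xp Xm +>\<^bsub>free_nonassoc Xp Xm\<^esub> F) = eval_poly (sl p q) \<phi> F"
    by (rule S.extension_coset[OF \<phi> F])
  also have "\<dots> = eval_poly ?C \<phi> F"
    using hom_eval_poly[OF S.nonassoc_algebra_axioms C.nonassoc_algebra_axioms incl
        S.polarized_carrier[OF \<phi>] F refl] .
  also have "\<dots> = eval_assoc (p + q) \<phi> (commutator_poly Xp Xm F)"
  proof (rule hom_eval_poly[OF W.nonassoc_algebra_axioms C.nonassoc_algebra_axioms
        algebra_hom_commutator[OF free_assoc_algebra matrix_nonassoc_algebra eval_assoc_hom[OF carr]]
        _ F, symmetric])
    show "(\<lambda>x. monomial [x]) ` (Xp \<union> Xm)
        \<subseteq> carrier (commutator_algebra (free_assoc Xp Xm :: ('k, 'x list \<Rightarrow> 'k) graded_algebra))"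
      by (auto intro!: free_assoc_monomial)
    show "eval_assoc (p + q) \<phi> (monomial [x]) = \<phi> x" if x: "x \<in> Xp \<union> Xm" for x
    proof -
      have "\<phi> x \<in> carrier_mat (p + q) (p + q)"
        using x carr by auto
      then show ?thesis
        using x by (simp add: eval_assoc_monomial[OF carr])
    qed
  qed
  finally show ?thesis .
qed

section \<open>The path matrices of an alternating word\<close>

text \<open>The vertices of the path of \<open>w\<close> are \<open>0, \<dots>, length w\<close>. A vertex is on the first side if it is left by a
  letter of \<open>Xp\<close>; the last vertex is left by no letter, so the letter that enters it decides. For the
  empty word the side of the single vertex \<open>0\<close> is arbitrary.\<close>

definition path_side :: "'x set \<Rightarrow> 'x list \<Rightarrow> nat \<Rightarrow> bool"
  where "path_side Xp w i \<longleftrightarrow> (if i < length w then w ! i \<in> Xp else w ! (i - 1) \<notin> Xp)"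

text \<open>Each block has room for all vertices, so that a vertex keeps its number within the block of its side.\<close>

definition path_vertex :: "'x set \<Rightarrow> 'x list \<Rightarrow> nat \<Rightarrow> nat"
  where "path_vertex Xp w i = (if path_side Xp w i then i else Suc (length w) + i)"

text \<open>The adjacency matrix of the edges labelled \<open>x\<close>.\<close>

definition path_matrix :: "'x set \<Rightarrow> 'x list \<Rightarrow> 'x \<Rightarrow> 'k::comm_ring_1 mat"
  where "path_matrix Xp w x = mat (Suc (length w) + Suc (length w)) (Suc (length w) + Suc (length w))
    (\<lambda>(a, b). of_bool (\<exists>i < length w. w ! i = x \<and> a = path_vertex Xp w i \<and>
      b = path_vertex Xp w (Suc i)))"

lemma path_side_Suc:
  assumes "alternating_word Xp w" "i < length w"
  shows "path_side Xp w (Suc i) \<longleftrightarrow> \<not> path_side Xp w i"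
  using assms by (auto simp: path_side_def alternating_word_def successively_conv_nth)

lemma path_vertex_less: "i \<le> length w \<Longrightarrow> path_vertex Xp w i < Suc (length w) + Suc (length w)"
  by (simp add: path_vertex_def)

lemma path_vertex_inj:
  "\<lbrakk>i \<le> length w; j \<le> length w\<rbrakk> \<Longrightarrow> path_vertex Xp w i = path_vertex Xp w j \<longleftrightarrow> i = j"
  by (auto simp: path_vertex_def split: if_splits)

lemma path_matrix_carrier:
  "path_matrix Xp w x \<in> carrier_mat (Suc (length w) + Suc (length w)) (Suc (length w) + Suc (length w))"
  by (simp add: path_matrix_def)

text \<open>Along each edge the side changes, from the first to the second exactly if the label is in \<open>Xp\<close>.\<close>

lemma path_matrix_polarized:
  assumes disjoint: "Xp \<inter> Xm = {}" and alt: "alternating_word Xp w"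
  shows "path_matrix Xp w \<in> polarized_maps Xp Xm
    (sl (Suc (length w)) (Suc (length w)) :: ('k::comm_ring_1, 'k mat) graded_algebra)"
proof -
  let ?n = "Suc (length w)"
  have entry: "(path_matrix Xp w x :: 'k mat) $$ (a, b) = 0"
    if "a < ?n + ?n" "b < ?n + ?n"
      "of_bool (a < ?n) - of_bool (b < ?n) \<noteq> (if x \<in> Xp then 1 else -1 :: int)" for a b x
  proof -
    have "of_bool (path_vertex Xp w i < ?n) - of_bool (path_vertex Xp w (Suc i) < ?n)
        = (if w ! i \<in> Xp then 1 else -1 :: int)" if "i < length w" for i
      using that path_side_Suc[OF alt that] by (auto simp: path_vertex_def) (auto simp: path_side_def)
    then have "\<not> (\<exists>i < length w. w ! i = x \<and> a = path_vertex Xp w i \<and> b = path_vertex Xp w (Suc i))"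
      using that(3) by auto
    then show ?thesis
      using that(1,2) by (simp add: path_matrix_def)
  qed
  have "trace (path_matrix Xp w x :: 'k mat) = 0" for x
    unfolding trace_def
  proof (rule sum.neutral, rule ballI)
    fix i assume "i \<in> {..<dim_row (path_matrix Xp w x :: 'k mat)}"
    then show "(path_matrix Xp w x :: 'k mat) $$ (i, i) = 0"
      by (intro entry) (auto simp: path_matrix_def)
  qed
  then have "(path_matrix Xp w x :: 'k mat) \<in> grade (sl ?n ?n) (if x \<in> Xp then 1 else -1)" for x
    using entry path_matrix_carrier[of Xp w x]
    by (intro sl_gradeI) (simp_all only: sl_sel(1) mem_Collect_eq simp_thms)
  note grade = this
  have "x \<in> Xp \<Longrightarrow> (path_matrix Xp w x :: 'k mat) \<in> grade (sl ?n ?n) 1"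
    "x \<in> Xm \<Longrightarrow> (path_matrix Xp w x :: 'k mat) \<in> grade (sl ?n ?n) (-1)" for x
    using grade[of x] disjoint by (auto split: if_splits)
  then show ?thesis
    by (auto simp: polarized_maps_def)
qed

text \<open>The entries of the value of \<open>v\<close> count the walks with label \<open>v\<close>. The walk that starts at vertex \<open>i\<close> has
  no choice: it follows the letters of \<open>w\<close> from position \<open>i\<close> on, so \<open>v\<close> must be the factor of \<open>w\<close> that
  begins there.\<close>

lemma eval_word_path_matrix:
  fixes w :: "'x list"
  defines "N \<equiv> Suc (length w) + Suc (length w)"
  assumes "i \<le> length w" "b < N"
  shows "(eval_word N (path_matrix Xp w) v :: 'k::comm_ring_1 mat) $$ (path_vertex Xp w i, b) =
    of_bool (i + length v \<le> length w \<and> take (length v) (drop i w) = v \<and>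
      b = path_vertex Xp w (i + length v))"
  using assms(2)
proof (induction v arbitrary: i)
  case Nil
  then show ?case
    using path_vertex_less[OF Nil, of Xp] assms(3) by (simp add: N_def)
next
  case (Cons x v)
  let ?E = "eval_word N (path_matrix Xp w) v :: 'k mat"
  have carr: "(path_matrix Xp w x :: 'k mat) \<in> carrier_mat N N" "?E \<in> carrier_mat N N"
    using path_matrix_carrier[of Xp w] eval_word_carrier[of "path_matrix Xp w" UNIV N v]
    by (auto simp: N_def)
  have vert: "path_vertex Xp w i < N"
    unfolding N_def using Cons.prems by (rule path_vertex_less)
  have "eval_word N (path_matrix Xp w) (x # v) $$ (path_vertex Xp w i, b)
      = (\<Sum>c < N. path_matrix Xp w x $$ (path_vertex Xp w i, c) * ?E $$ (c, b))"
    using carr vert assms(3) by (auto simp: scalar_prod_def atLeast0LessThan intro!: sum.cong)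
  also have "\<dots> = (\<Sum>c < N. if c = path_vertex Xp w (Suc i)
      then of_bool (i < length w \<and> w ! i = x) * ?E $$ (c, b) else 0)"
  proof (rule sum.cong)
    fix c assume "c \<in> {..<N}"
    moreover have "(\<exists>j < length w. w ! j = x \<and> path_vertex Xp w i = path_vertex Xp w j \<and>
        c = path_vertex Xp w (Suc j)) \<longleftrightarrow>
        i < length w \<and> w ! i = x \<and> c = path_vertex Xp w (Suc i)"
      using Cons.prems by (auto simp: path_vertex_inj)
    ultimately show "path_matrix Xp w x $$ (path_vertex Xp w i, c) * ?E $$ (c, b)
      = (if c = path_vertex Xp w (Suc i)
          then of_bool (i < length w \<and> w ! i = x) * ?E $$ (c, b) else 0)"
      using vert by (simp add: path_matrix_def N_def)
  qed simp
  also have "\<dots> = of_bool (i < length w \<and> w ! i = x) * ?E $$ (path_vertex Xp w (Suc i), b)"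
    using path_vertex_less[of "Suc i" w Xp] by (auto simp: N_def)
  also have "\<dots> = of_bool (i + length (x # v) \<le> length w \<and> take (length (x # v)) (drop i w) = x # v \<and>
      b = path_vertex Xp w (i + length (x # v)))"
  proof (cases "i < length w")
    case True
    then show ?thesis
      using Cons.IH[of "Suc i"] by (auto simp: Cons_nth_drop_Suc[symmetric])
  qed auto
  finally show ?case .
qed

text \<open>A walk from the first to the last vertex has length \<open>length w\<close>, hence spells \<open>w\<close>.\<close>

lemma eval_assoc_path_matrix:
  fixes G :: "'x list \<Rightarrow> 'k::comm_ring_1" and w :: "'x list"
  defines "N \<equiv> Suc (length w) + Suc (length w)"
  assumes "G \<in> carrier (free_assoc Xp Xm)"
  shows "eval_assoc N (path_matrix Xp w) G $$ (path_vertex Xp w 0, path_vertex Xp w (length w)) = G w"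
proof (rule eval_assoc_entry_eqI[OF _ _ _ assms(2)])
  show "path_matrix Xp w ` (Xp \<union> Xm) \<subseteq> carrier_mat N N"
    unfolding N_def by (intro image_subsetI path_matrix_carrier)
  show less: "path_vertex Xp w 0 < N" "path_vertex Xp w (length w) < N"
    unfolding N_def by (simp_all only: path_vertex_less le0 order_refl)
  show "eval_word N (path_matrix Xp w) v $$ (path_vertex Xp w 0, path_vertex Xp w (length w))
      = (if v = w then 1 else 0)" for v
  proof -
    have "0 + length v \<le> length w \<and> take (length v) (drop 0 w) = v \<and>
        path_vertex Xp w (length w) = path_vertex Xp w (0 + length v) \<longleftrightarrow> v = w"
      by (auto simp: path_vertex_inj)
    then show ?thesis
      unfolding N_def eval_word_path_matrix[OF le0 less(2)[unfolded N_def]] by simp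
  qed
qed

section \<open>Leading terms\<close>

text \<open>The part that is dropped consists of words in the ideal.\<close>

lemma alternating_representative:
  fixes G :: "'x list \<Rightarrow> 'k::comm_ring_1"
  assumes G: "G \<in> carrier (free_assoc Xp Xm)"
  defines "H \<equiv> \<lambda>w. if alternating_word Xp w then G w else 0"
  shows "H \<in> carrier (free_assoc Xp Xm)"
    and "assoc_ideal Xp Xm +>\<^bsub>free_assoc Xp Xm\<^esub> H = assoc_ideal Xp Xm +>\<^bsub>free_assoc Xp Xm\<^esub> G"
proof -
  let ?F = "free_assoc Xp Xm :: ('k, 'x list \<Rightarrow> 'k) graded_algebra"
  define N where "N = (\<lambda>w. if alternating_word Xp w then 0 else G w)"
  have "{w. H w \<noteq> 0} \<subseteq> {w. G w \<noteq> 0}" "{w. N w \<noteq> 0} \<subseteq> {w. G w \<noteq> 0}"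
    by (auto simp: H_def N_def)
  then have carr: "H \<in> carrier ?F" "N \<in> carrier ?F"
    using G finite_subset unfolding free_assoc_sel(1) by blast+
  then show "H \<in> carrier ?F"
    by simp
  have "N \<in> assoc_ideal Xp Xm"
    by (rule assoc_ideal_if_no_alternating[OF carr(2)]) (simp add: N_def)
  moreover have "N \<oplus>\<^bsub>?F\<^esub> H = G"
    by (auto simp: free_assoc_sel(3) N_def H_def)
  ultimately show "assoc_ideal Xp Xm +>\<^bsub>?F\<^esub> H = assoc_ideal Xp Xm +>\<^bsub>?F\<^esub> G"
    using coset_add_ideal[OF free_assoc_algebra algebra_ideal_assoc_ideal carr(1)] by metis
qed

lemma monic_multiple:
  fixes G :: "'x list \<Rightarrow> 'k::comm_ring_1"
  assumes field: "Ring.field (class_ring :: 'k ring)"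
    and G: "G \<in> carrier (free_assoc Xp Xm)" "G \<notin> assoc_ideal Xp Xm"
  shows "\<exists>u. u dvd 1 \<and> has_monic_leading_term Xp
    (u \<odot>\<^bsub>SL Xp Xm\<^esub> (assoc_ideal Xp Xm +>\<^bsub>free_assoc Xp Xm\<^esub> G))"
proof -
  let ?F = "free_assoc Xp Xm :: ('k, 'x list \<Rightarrow> 'k) graded_algebra"
  let ?q = "\<lambda>G. assoc_ideal Xp Xm +>\<^bsub>?F\<^esub> G"
  interpret F: nonassoc_algebra ?F
    by (rule free_assoc_algebra)
  interpret J: abelian_subgroup "assoc_ideal Xp Xm" ?F
    by (rule ideal_abelian_subgroup[OF free_assoc_algebra algebra_ideal_assoc_ideal])
  define H where "H = (\<lambda>w. if alternating_word Xp w then G w else 0)"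
  have H: "H \<in> carrier ?F" "?q H = ?q G"
    using alternating_representative[OF G(1)] by (simp_all add: H_def)
  obtain w0 where "alternating_word Xp w0" "G w0 \<noteq> 0"
    using assoc_ideal_if_no_alternating[OF G(1)] G(2) by blast
  then have "{w. H w \<noteq> 0} \<noteq> {}" "finite {w. H w \<noteq> 0}"
    using H(1) by (auto simp: H_def free_assoc_sel(1))
  note supp = this
  then have "Max (length ` {w. H w \<noteq> 0}) \<in> length ` {w. H w \<noteq> 0}"
    by (intro Max_in) auto
  then obtain w where "H w \<noteq> 0" "length w = Max (length ` {w. H w \<noteq> 0})"
    by auto
  with supp(2) have w: "H w \<noteq> 0" "\<And>v. H v \<noteq> 0 \<Longrightarrow> length v \<le> length w"
    by simp_all
  \<comment> \<open>The multiplier is the inverse of the coefficient at a longest word.\<close>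
  obtain u where u: "H w * u = 1"
    using field.field_Units[OF field] w(1) by (auto simp: Units_def set_eq_iff)
  have "(u \<odot>\<^bsub>SL Xp Xm\<^esub> ?q G) = ?q (\<lambda>w. u * H w)"
    using quotient_smult[OF free_assoc_algebra algebra_ideal_assoc_ideal H(1), of u]
    by (simp add: SL_sel(4) Ass_def H(2) free_assoc_sel(4))
  moreover have "(\<lambda>w. u * H w) \<in> ?q (\<lambda>w. u * H w)"
    using F.smult_carrier[OF H(1), of u] by (intro J.a_rcos_self) (simp add: free_assoc_sel(4))
  moreover have "u * H v \<noteq> 0 \<longrightarrow> alternating_word Xp v" for v
    by (simp add: H_def)
  moreover have "u * H v \<noteq> 0 \<longrightarrow> length v \<le> length w" for v
    using w(2)[of v] by (metis mult_zero_right)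
  moreover have "u * H w = 1" "u dvd 1"
    using u by (auto simp: mult.commute dvd_def intro!: exI[of _ "H w"])
  ultimately show ?thesis
    unfolding has_monic_leading_term_def by metis
qed

section \<open>Identities of the algebras of traceless matrices\<close>

theorem proposition5p7:
  fixes Xp Xm :: "'x set" and f :: "('x magma \<Rightarrow> 'k::comm_ring_1) set"
  assumes half: "(2 :: 'k) dvd 1"
    and disjoint: "Xp \<inter> Xm = {}"
    and f: "f \<in> carrier (free_lie Xp Xm)"
  shows "(special_proj Xp Xm f \<noteq> \<zero>\<^bsub>SL Xp Xm\<^esub> \<longleftrightarrow>
      (\<exists>p q. \<not> is_identity Xp Xm f (sl p q :: ('k, 'k mat) graded_algebra)))
    \<and> (Ring.field (class_ring :: 'k ring) \<longrightarrow>
        (essential Xp Xm f \<longleftrightarrow>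
          (\<exists>p q. \<not> is_identity Xp Xm f (sl p q :: ('k, 'k mat) graded_algebra))))"
proof -
  obtain F where F: "F \<in> carrier (free_nonassoc Xp Xm)"
    and f_eq: "f = lie_ideal Xp Xm +>\<^bsub>free_nonassoc Xp Xm\<^esub> F"
    using f by (auto simp: free_lie_def quotient_algebra_sel)
  define G where "G = commutator_poly Xp Xm F"
  have G: "G \<in> carrier (free_assoc Xp Xm)"
    using commutator_poly_carrier[OF F] by (simp add: G_def)
  have proj: "special_proj Xp Xm f = assoc_ideal Xp Xm +>\<^bsub>free_assoc Xp Xm\<^esub> G"
    unfolding f_eq G_def by (rule special_proj_coset[OF disjoint F])
  have zero_iff: "special_proj Xp Xm f = \<zero>\<^bsub>SL Xp Xm\<^esub> \<longleftrightarrow> G \<in> assoc_ideal Xp Xm"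
    unfolding proj SL_sel(2) by (rule coset_eq_zero_iff[OF free_assoc_algebra algebra_ideal_assoc_ideal G])
  have ext: "extension Xp Xm (sl p q) \<phi> f = eval_assoc (p + q) \<phi> G"
    if "\<phi> \<in> polarized_maps Xp Xm (sl p q :: ('k, 'k mat) graded_algebra)" for p q \<phi>
    unfolding f_eq G_def by (rule extension_sl_coset[OF that F])
  have main: "G \<notin> assoc_ideal Xp Xm \<longleftrightarrow>
      (\<exists>p q. \<not> is_identity Xp Xm f (sl p q :: ('k, 'k mat) graded_algebra))"
  proof
    assume "G \<notin> assoc_ideal Xp Xm"
    then obtain w where w: "alternating_word Xp w" "G w \<noteq> 0"
      using assoc_ideal_if_no_alternating[OF G] by blast
    let ?n = "Suc (length w)"
    let ?\<phi> = "path_matrix Xp w :: 'x \<Rightarrow> 'k mat"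
    have \<phi>: "?\<phi> \<in> polarized_maps Xp Xm (sl ?n ?n)"
      by (rule path_matrix_polarized[OF disjoint w(1)])
    have "eval_assoc (?n + ?n) ?\<phi> G $$ (path_vertex Xp w 0, path_vertex Xp w (length w)) \<noteq> 0"
      using eval_assoc_path_matrix[OF G, of w] w(2) by simp
    then have "extension Xp Xm (sl ?n ?n) ?\<phi> f \<noteq> \<zero>\<^bsub>sl ?n ?n\<^esub>"
      using path_vertex_less[of 0 w Xp] path_vertex_less[of "length w" w Xp]
      by (auto simp: ext[OF \<phi>] sl_sel(4))
    then show "\<exists>p q. \<not> is_identity Xp Xm f (sl p q :: ('k, 'k mat) graded_algebra)"
      using \<phi> unfolding is_identity_def by blast
  next
    assume "\<exists>p q. \<not> is_identity Xp Xm f (sl p q :: ('k, 'k mat) graded_algebra)"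
    then show "G \<notin> assoc_ideal Xp Xm"
      using ext assoc_ideal_kernel by (fastforce simp: is_identity_def sl_sel(4))
  qed
  have "essential Xp Xm f \<longleftrightarrow> G \<notin> assoc_ideal Xp Xm" if "Ring.field (class_ring :: 'k ring)"
    using monic_multiple[OF that G] zero_iff proj by (auto simp: essential_def)
  then show ?thesis
    using zero_iff main by blast
qed

end
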